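(* Let $(\mathbb{R}^n,g)$ be a pseudo-Euclidean space, $n\ge 3$, with coordinates $x=(x_1,\dots,x_n)$ and $g_{ij}=\delta_{ij}\varepsilon_i$, $\varepsilon_i\in\{-1,1\}$. Let $M=(\mathbb{R}^n,\bar g)\times_f F^m$ be a warped product, where $\bar g=\frac{1}{\varphi^2}g$, $F$ is a semi-Riemannian manifold of dimension $m\ge 1$ with constant scalar curvature $\lambda_F$, $f,\varphi,h:\mathbb{R}^n\to\mathbb{R}$ are smooth functions, and $f$ is positive. Let $\rho\in\mathbb{R}$. Then the warped product metric $\tilde g=\bar g\oplus f^2g_F$ is a gradient Yamabe soliton with potential function $h$ and constant $\rho$, that is, $(S_{\tilde g}-\rho)\tilde g=\mathrm{Hess}_{\tilde g}(h)$, if and only if $f,\varphi,h$ satisfy the following equations. For all $i\ne j$: $$h_{,x_ix_j}+\frac{\varphi_{,x_j}}{\varphi}h_{,x_i}+\frac{\varphi_{,x_i}}{\varphi}h_{,x_j}=0;$$ for all $i\in\{1,\dots,n\}$: $$\Big[(n-1)\Big(2\varphi\sum_k\varepsilon_k\varphi_{,x_kx_k}-n\sum_k\varepsilon_k\varphi_{,x_k}^2\Big)+\frac{\lambda_F}{f^2}-\frac{2m}{f}\Big(\varphi^2\sum_k\varepsilon_kf_{,x_kx_k}-(n-2)\varphi\sum_k\varepsilon_k\varphi_{,x_k}f_{,x_k}\Big)-\frac{m(m-1)}{f^2}\varphi^2\sum_k\varepsilon_kf_{,x_k}^2-\rho\Big]\frac{\varepsilon_i}{\varphi^2}$$ $$=h_{,x_ix_i}+2\frac{\varphi_{,x_i}}{\varphi}h_{,x_i}-\varepsilon_i\sum_k\varepsilon_k\frac{\varphi_{,x_k}}{\varphi}h_{,x_k};$$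 and $$(n-1)\Big(2\varphi\sum_k\varepsilon_k\varphi_{,x_kx_k}-n\sum_k\varepsilon_k\varphi_{,x_k}^2\Big)+\frac{\lambda_F}{f^2}-\frac{2m}{f}\Big(\varphi^2\sum_k\varepsilon_kf_{,x_kx_k}-(n-2)\varphi\sum_k\varepsilon_k\varphi_{,x_k}f_{,x_k}\Big)-\frac{m(m-1)}{f^2}\varphi^2\sum_k\varepsilon_kf_{,x_k}^2-\rho=\frac{\varphi^2}{f}\sum_k\varepsilon_kf_{,x_k}h_{,x_k}.$$
   Context: A pseudo-Riemannian manifold $(M,g)$ is a gradient Yamabe soliton with potential function $h$ if there is a real constant $\rho$ with $(S_g-\rho)g=\mathrm{Hess}_g(h)$, where $S_g$ is the scalar curvature. The warped product $B\times_f F$ is $B\times F$ with metric $\tilde g=g_B\oplus f^2g_F$. The function $h$ on $\mathbb{R}^n$ is regarded as a function on $M=\mathbb{R}^n\times F$ by composing with the projection to $\mathbb{R}^n$. Since $\bar g=\frac1{\varphi^2}g$ must be a metric, $\varphi$ is nowhere zero. Subscripts $,x_i$ and $,x_ix_j$ denote first and second partial derivatives; sums over $k$ run from $1$ to $n$. *)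

theory Defs
  imports "HOL-Analysis.Analysis"
begin

section \<open>Partial derivatives and smooth maps between coordinate spaces\<close>

definition pd :: "'n::finite \<Rightarrow> (real^'n \<Rightarrow> 'b::real_normed_vector) \<Rightarrow> real^'n \<Rightarrow> 'b" where
  "pd k u x = frechet_derivative u (at x) (axis k 1)"

text \<open>Used on open sets only.\<close>

primrec Ck_on :: "nat \<Rightarrow> (real^'n::finite) set \<Rightarrow> (real^'n \<Rightarrow> 'b::real_normed_vector) \<Rightarrow> bool" where
  "Ck_on 0 S u \<longleftrightarrow> continuous_on S u"
| "Ck_on (Suc r) S u \<longleftrightarrow> (\<forall>x\<in>S. u differentiable at x) \<and> (\<forall>k. Ck_on r S (pd k u))"

definition smooth_on :: "(real^'n::finite) set \<Rightarrow> (real^'n \<Rightarrow> 'b::real_normed_vector) \<Rightarrow> bool" where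
  "smooth_on S u \<longleftrightarrow> (\<forall>r. Ck_on r S u)"


section \<open>Smooth manifolds\<close>

text \<open>
  A manifold of dimension \<open>CARD('n)\<close> is a topological space with an indexed family of charts;
  \<open>chart M i\<close> is only meaningful on \<open>cdom M i\<close>. The atlas need not be maximal.
\<close>

record ('p, 'i, 'n) manifold =
  mtop :: "'p topology"
  idx :: "'i set"
  cdom :: "'i \<Rightarrow> 'p set"
  chart :: "'i \<Rightarrow> 'p \<Rightarrow> real^'n"

definition cimage :: "('p, 'i, 'n::finite) manifold \<Rightarrow> 'i \<Rightarrow> (real^'n) set" where
  "cimage M i = chart M i ` cdom M i"

definition loc :: "('p, 'i, 'n::finite) manifold \<Rightarrow> 'i \<Rightarrow> ('p \<Rightarrow> 'b) \<Rightarrow> real^'n \<Rightarrow> 'b" where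
  "loc M i u = u \<circ> inv_into (cdom M i) (chart M i)"

definition smooth_manifold :: "('p, 'i, 'n::finite) manifold \<Rightarrow> bool" where
  "smooth_manifold M \<longleftrightarrow>
     Hausdorff_space (mtop M) \<and> second_countable (mtop M) \<and> topspace (mtop M) \<noteq> {} \<and>
     (\<Union>i\<in>idx M. cdom M i) = topspace (mtop M) \<and>
     (\<forall>i\<in>idx M. openin (mtop M) (cdom M i) \<and> open (cimage M i) \<and>
        homeomorphic_map (subtopology (mtop M) (cdom M i)) (top_of_set (cimage M i)) (chart M i)) \<and>
     (\<forall>i\<in>idx M. \<forall>j\<in>idx M.
        smooth_on (chart M i ` (cdom M i \<inter> cdom M j)) (loc M i (chart M j)))"

definition smooth_function :: "('p, 'i, 'n::finite) manifold \<Rightarrow> ('p \<Rightarrow> real) \<Rightarrow> bool" where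
  "smooth_function M u \<longleftrightarrow> (\<forall>i\<in>idx M. smooth_on (cimage M i) (loc M i u))"


section \<open>Pseudo-Riemannian metrics\<close>

text \<open>
  A metric is given by its coordinate matrices: \<open>g i x $ a $ b\<close> is the component
  \<open>g(\<partial>\<^sub>a, \<partial>\<^sub>b)\<close> in the chart \<open>i\<close>, at the point with coordinates \<open>x\<close>.
  The last clause is the transformation law of a (0,2) tensor.
  Nondegeneracy makes the index locally constant; no further condition on it is imposed.
\<close>

type_synonym ('i, 'n) metric = "'i \<Rightarrow> real^'n \<Rightarrow> real^'n^'n"

definition pseudo_Riemannian :: "('p, 'i, 'n::finite) manifold \<Rightarrow> ('i, 'n) metric \<Rightarrow> bool" where
  "pseudo_Riemannian M g \<longleftrightarrow>
     smooth_manifold M \<and>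
     (\<forall>i\<in>idx M. smooth_on (cimage M i) (g i)) \<and>
     (\<forall>i\<in>idx M. \<forall>x\<in>cimage M i. transpose (g i x) = g i x \<and> invertible (g i x)) \<and>
     (\<forall>i\<in>idx M. \<forall>j\<in>idx M. \<forall>p\<in>cdom M i \<inter> cdom M j.
        let J = jacobian (loc M i (chart M j)) (at (chart M i p))
        in g i (chart M i p) = transpose J ** g j (chart M j p) ** J)"


section \<open>Curvature and Hessian in coordinates\<close>

text \<open>In this section \<open>G\<close> is the coordinate matrix of a metric in one chart.\<close>

definition christoffel ::
    "(real^'n \<Rightarrow> real^'n^'n) \<Rightarrow> 'n::finite \<Rightarrow> 'n \<Rightarrow> 'n \<Rightarrow> real^'n \<Rightarrow> real" where
  "christoffel G k i j x =
     (1/2) * (\<Sum>l\<in>UNIV. matrix_inv (G x) $ k $ l *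
        (pd i (\<lambda>y. G y $ j $ l) x + pd j (\<lambda>y. G y $ i $ l) x - pd l (\<lambda>y. G y $ i $ j) x))"

text \<open>\<open>riemann G l k i j\<close> is the \<open>\<partial>\<^sub>l\<close>-component of
  \<open>R(\<partial>\<^sub>i, \<partial>\<^sub>j)\<partial>\<^sub>k\<close> with
  \<open>R(X,Y) = \<nabla>\<^sub>X \<nabla>\<^sub>Y - \<nabla>\<^sub>Y \<nabla>\<^sub>X - \<nabla>\<^bsub>[X,Y]\<^esub>\<close>;
  round spheres have positive scalar curvature.\<close>

definition riemann ::
    "(real^'n \<Rightarrow> real^'n^'n) \<Rightarrow> 'n::finite \<Rightarrow> 'n \<Rightarrow> 'n \<Rightarrow> 'n \<Rightarrow> real^'n \<Rightarrow> real" where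
  "riemann G l k i j x =
     pd i (christoffel G l j k) x - pd j (christoffel G l i k) x +
     (\<Sum>q\<in>UNIV. christoffel G l i q x * christoffel G q j k x
                  - christoffel G l j q x * christoffel G q i k x)"

definition ricci ::
    "(real^'n \<Rightarrow> real^'n^'n) \<Rightarrow> 'n::finite \<Rightarrow> 'n \<Rightarrow> real^'n \<Rightarrow> real" where
  "ricci G j k x = (\<Sum>i\<in>UNIV. riemann G i k i j x)"

definition scalar_curvature :: "(real^'n::finite \<Rightarrow> real^'n^'n) \<Rightarrow> real^'n \<Rightarrow> real" where
  "scalar_curvature G x = (\<Sum>j\<in>UNIV. \<Sum>k\<in>UNIV. matrix_inv (G x) $ j $ k * ricci G j k x)"

definition hessian ::
    "(real^'n \<Rightarrow> real^'n^'n) \<Rightarrow> (real^'n \<Rightarrow> real) \<Rightarrow> real^'n::finite \<Rightarrow> real^'n^'n" where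
  "hessian G u x = (\<chi> i j. pd i (pd j u) x - (\<Sum>k\<in>UNIV. christoffel G k i j x * pd k u x))"

definition constant_scalar_curvature ::
    "('p, 'i, 'n::finite) manifold \<Rightarrow> ('i, 'n) metric \<Rightarrow> real \<Rightarrow> bool" where
  "constant_scalar_curvature M g c \<longleftrightarrow>
     (\<forall>i\<in>idx M. \<forall>x\<in>cimage M i. scalar_curvature (g i) x = c)"

definition gradient_Yamabe_soliton ::
    "('p, 'i, 'n::finite) manifold \<Rightarrow> ('i, 'n) metric \<Rightarrow> ('p \<Rightarrow> real) \<Rightarrow> real \<Rightarrow> bool" where
  "gradient_Yamabe_soliton M g u \<rho> \<longleftrightarrow>
     pseudo_Riemannian M g \<and> smooth_function M u \<and>
     (\<forall>i\<in>idx M. \<forall>x\<in>cimage M i.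
        (scalar_curvature (g i) x - \<rho>) *\<^sub>R g i x = hessian (g i) (loc M i u) x)"


section \<open>Pseudo-Euclidean space, conformal metrics, warped products\<close>

definition Euclidean_manifold :: "(real^'n, unit, 'n::finite) manifold" where
  "Euclidean_manifold =
     \<lparr>mtop = euclidean, idx = UNIV, cdom = (\<lambda>_. UNIV), chart = (\<lambda>_ x. x)\<rparr>"

definition pseudo_Euclidean_metric :: "('n \<Rightarrow> real) \<Rightarrow> (unit, 'n::finite) metric" where
  "pseudo_Euclidean_metric \<epsilon> = (\<lambda>_ _. \<chi> i j. if i = j then \<epsilon> i else 0)"

text \<open>The metric \<open>(1/\<phi>\<^sup>2) g\<close>.\<close>

definition conformal_metric ::
    "('p, 'i, 'n::finite) manifold \<Rightarrow> ('p \<Rightarrow> real) \<Rightarrow> ('i, 'n) metric \<Rightarrow> ('i, 'n) metric" where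
  "conformal_metric M \<phi> g = (\<lambda>i x. (1 / (loc M i \<phi> x)\<^sup>2) *\<^sub>R g i x)"

text \<open>Coordinates on a product are indexed by the disjoint sum \<open>'n + 'm\<close> of the index types.\<close>

definition vjoin :: "real^'n::finite \<Rightarrow> real^'m::finite \<Rightarrow> real^('n + 'm)" where
  "vjoin x y = (\<chi> k. case k of Inl a \<Rightarrow> x $ a | Inr b \<Rightarrow> y $ b)"

definition vleft :: "real^('n::finite + 'm::finite) \<Rightarrow> real^'n" where
  "vleft z = (\<chi> a. z $ Inl a)"

definition vright :: "real^('n::finite + 'm::finite) \<Rightarrow> real^'m" where
  "vright z = (\<chi> b. z $ Inr b)"

definition product_manifold ::
    "('p, 'i, 'n::finite) manifold \<Rightarrow> ('q, 'j, 'm::finite) manifold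
      \<Rightarrow> ('p \<times> 'q, 'i \<times> 'j, 'n + 'm) manifold" where
  "product_manifold B F =
     \<lparr>mtop = prod_topology (mtop B) (mtop F),
      idx = idx B \<times> idx F,
      cdom = (\<lambda>(i, j). cdom B i \<times> cdom F j),
      chart = (\<lambda>(i, j) (p, q). vjoin (chart B i p) (chart F j q))\<rparr>"

text \<open>The metric \<open>g\<^sub>B \<oplus> f\<^sup>2 g\<^sub>F\<close> on \<open>B \<times> F\<close>.\<close>

definition warped_metric ::
    "('p, 'i, 'n::finite) manifold \<Rightarrow> ('i, 'n) metric \<Rightarrow> ('p \<Rightarrow> real)
      \<Rightarrow> ('j, 'm::finite) metric \<Rightarrow> ('i \<times> 'j, 'n + 'm) metric" where
  "warped_metric B gB f gF = (\<lambda>(i, j) z. \<chi> k l.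
     case (k, l) of
       (Inl a, Inl b) \<Rightarrow> gB i (vleft z) $ a $ b
     | (Inr a, Inr b) \<Rightarrow> (loc B i f (vleft z))\<^sup>2 * gF j (vright z) $ a $ b
     | _ \<Rightarrow> 0)"

end

theory Submission
  imports Defs
begin

text \<open>
  In a product chart the warped metric is the block matrix with blocks \<open>G(x)\<close> and
  \<open>f(x)\<^sup>2 H(y)\<close>. Its Christoffel symbols are those of the two factors together with the
  mixed terms \<open>\<Gamma>\<^sup>c\<^sub>\<alpha>\<^sub>\<beta> = - f (\<nabla>f)\<^sup>c H\<^sub>\<alpha>\<^sub>\<beta>\<close> and
  \<open>\<Gamma>\<^sup>\<gamma>\<^sub>a\<^sub>\<beta> = (\<partial>\<^sub>a f / f) \<delta>\<^sup>\<gamma>\<^sub>\<beta>\<close>. Two consequences carry the theorem.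

  First, the scalar curvature is
  \<open>S\<^sub>G + S\<^sub>H / f\<^sup>2 - (m/f) (tr Hess f + div \<nabla>f) - m (m - 1) |\<nabla>f|\<^sup>2 / f\<^sup>2\<close>
  (lemma \<open>scalar_curvature_W\<close>). Since \<open>S\<^sub>H\<close> is the constant \<open>\<lambda>\<^sub>F\<close>,
  it depends on \<open>x\<close> only.

  Second, the Hessian of a function of \<open>x\<close> is again block diagonal, with blocks
  \<open>Hess\<^sub>G h\<close> and \<open>f \<langle>\<nabla>f, \<nabla>h\<rangle> H\<close> (lemma \<open>hessian_W\<close>).
  The soliton equation therefore splits into its two diagonal blocks. In the fibre block both sides are
  multiples of the nonzero matrix \<open>H\<close>, so that block is one scalar equation, and nothing in it
  depends on the point of \<open>F\<close>. This gives a pair of equations on an arbitrary base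
  (theorem \<open>warped_soliton_iff\<close>).

  For the base metric \<open>\<phi>\<^sup>-\<^sup>2 g\<close> everything is explicit in the logarithmic derivatives
  \<open>\<phi>\<^sub>,\<^sub>k / \<phi>\<close>: the off-diagonal entries, the diagonal entries and the fibre equation
  are the three families of the theorem.

  A soliton is by definition a pseudo-Riemannian manifold with a smooth potential, so deriving the
  soliton from the equations also requires that the product atlas and the warped metric are smooth,
  nondegenerate and compatible under changes of charts. This holds because transition maps of a product have block diagonal Jacobians (lemmas \<open>smooth_manifold_product\<close>
  and \<open>pseudo_Riemannian_warped\<close>).
\<close>

section \<open>Calculus of coordinate partial derivatives\<close>

lemma pd_eqI: "(u has_derivative D) (at x) \<Longrightarrow> pd k u x = D (axis k 1)"
  unfolding pd_def by (simp add: frechet_derivative_at[symmetric])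

lemma has_derivative_frechet:
  "u differentiable at x \<Longrightarrow> (u has_derivative frechet_derivative u (at x)) (at x)"
  by (simp add: frechet_derivative_works)

lemma has_derivative_cong_open:
  assumes "open S" "x \<in> S" "\<And>y. y \<in> S \<Longrightarrow> u y = v y"
  shows "(u has_derivative D) (at x) \<longleftrightarrow> (v has_derivative D) (at x)"
  using assms has_derivative_transform_within_open[of u D x UNIV S v]
    has_derivative_transform_within_open[of v D x UNIV S u] by auto

lemma differentiable_cong_open:
  assumes "open S" "x \<in> S" "\<And>y. y \<in> S \<Longrightarrow> u y = v y"
  shows "u differentiable at x \<longleftrightarrow> v differentiable at x"
  using has_derivative_cong_open[of S x u v, OF assms] by (simp add: differentiable_def)

text \<open>Both Frechet derivatives are choices from the same set of derivatives, so they agree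
  even where that set is empty. The definition of smoothness on a set unfolds into derivatives of
  arbitrary order, and this lemma lets each of them be replaced by a formula valid on an open set.\<close>

lemma pd_cong_open:
  assumes "open S" "x \<in> S" "\<And>y. y \<in> S \<Longrightarrow> u y = v y"
  shows "pd k u x = pd k v x"
proof -
  have "(\<lambda>D. (u has_derivative D) (at x)) = (\<lambda>D. (v has_derivative D) (at x))"
    using has_derivative_cong_open[of S x u v, OF assms] by blast
  then show ?thesis
    unfolding pd_def frechet_derivative_def by simp
qed

lemma pd_const [simp]: "pd k (\<lambda>x. c) x = 0"
  by (simp add: pd_eqI[OF has_derivative_const])

lemma pd_add:
  assumes "u differentiable at x" "v differentiable at x"
  shows "pd k (\<lambda>x. u x + v x) x = pd k u x + pd k v x"
  using pd_eqI[OF has_derivative_add[OF assms[THEN has_derivative_frechet]]]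
  by (simp add: pd_def)

lemma pd_mult:
  fixes u v :: "real^'n::finite \<Rightarrow> real"
  assumes "u differentiable at x" "v differentiable at x"
  shows "pd k (\<lambda>x. u x * v x) x = pd k u x * v x + u x * pd k v x"
  using pd_eqI[OF has_derivative_mult[OF assms[THEN has_derivative_frechet]]]
  by (simp add: pd_def)

lemma pd_cmult:
  fixes u :: "real^'n::finite \<Rightarrow> real"
  assumes "u differentiable at x"
  shows "pd k (\<lambda>x. c * u x) x = c * pd k u x"
  using pd_mult[of "\<lambda>_. c" x u k] assms by simp

lemma pd_minus:
  assumes "u differentiable at x"
  shows "pd k (\<lambda>x. - u x) x = - pd k u x"
  using pd_eqI[OF has_derivative_minus[OF assms[THEN has_derivative_frechet]]]
  by (simp add: pd_def)

lemma pd_diff: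
  assumes "u differentiable at x" "v differentiable at x"
  shows "pd k (\<lambda>x. u x - v x) x = pd k u x - pd k v x"
  using pd_eqI[OF has_derivative_diff[OF assms[THEN has_derivative_frechet]]]
  by (simp add: pd_def)

lemma pd_inverse:
  fixes u :: "real^'n::finite \<Rightarrow> real"
  assumes "u differentiable at x" "u x \<noteq> 0"
  shows "pd k (\<lambda>x. inverse (u x)) x = - pd k u x * (inverse (u x) * inverse (u x))"
  using pd_eqI[OF Deriv.has_derivative_inverse[OF assms(2) assms(1)[THEN has_derivative_frechet]]]
  by (simp add: pd_def mult_ac)

lemma pd_bounded_linear:
  assumes "bounded_linear L" "u differentiable at x"
  shows "pd k (\<lambda>x. L (u x)) x = L (pd k u x)"
  using pd_eqI[OF bounded_linear.has_derivative[OF assms(1) assms(2)[THEN has_derivative_frechet]]]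
  by (simp add: pd_def)

lemma pd_nth:
  assumes "u differentiable at x"
  shows "pd k (\<lambda>x. u x $ i) x = pd k u x $ i"
  using pd_bounded_linear[OF bounded_linear_vec_nth assms] .

lemma differentiable_bounded_linear:
  assumes "bounded_linear L" "u differentiable at x"
  shows "(\<lambda>x. L (u x)) differentiable at x"
  using bounded_linear.has_derivative[OF assms(1) assms(2)[THEN has_derivative_frechet]]
  by (auto simp: differentiable_def)

lemma differentiable_nth:
  "u differentiable at x \<Longrightarrow> (\<lambda>x. u x $ i) differentiable at x"
  by (rule differentiable_bounded_linear[OF bounded_linear_vec_nth])

lemma frechet_derivative_eq_sum_pd:
  fixes u :: "real^'n::finite \<Rightarrow> 'b::real_normed_vector"
  assumes "u differentiable at x"
  shows "frechet_derivative u (at x) v = (\<Sum>k\<in>UNIV. v $ k *\<^sub>R pd k u x)"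
proof -
  interpret D: bounded_linear "frechet_derivative u (at x)"
    using has_derivative_frechet[OF assms] by (rule has_derivative_bounded_linear)
  have "v = (\<Sum>k\<in>UNIV. v $ k *\<^sub>R axis k 1)"
    using basis_expansion[of v] by (simp add: scalar_mult_eq_scaleR)
  then have "frechet_derivative u (at x) v
      = frechet_derivative u (at x) (\<Sum>k\<in>UNIV. v $ k *\<^sub>R axis k 1)" by simp
  then show ?thesis by (simp add: D.sum D.scaleR pd_def)
qed

lemma has_derivative_compose_linear:
  fixes u :: "real^'a::finite \<Rightarrow> 'b::real_normed_vector" and L :: "real^'c::finite \<Rightarrow> real^'a"
  assumes "bounded_linear L" "u differentiable at (L z)"
  shows "((\<lambda>z. u (L z)) has_derivative (\<lambda>v. frechet_derivative u (at (L z)) (L v))) (at z)"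
  using has_derivative_compose[OF bounded_linear_imp_has_derivative[OF assms(1)]
      has_derivative_frechet[OF assms(2)]] .

lemma pd_compose_linear:
  fixes u :: "real^'a::finite \<Rightarrow> 'b::real_normed_vector" and L :: "real^'c::finite \<Rightarrow> real^'a"
  assumes "bounded_linear L" "u differentiable at (L z)"
  shows "pd k (\<lambda>z. u (L z)) z = (\<Sum>j\<in>UNIV. L (axis k 1) $ j *\<^sub>R pd j u (L z))"
  using pd_eqI[OF has_derivative_compose_linear[OF assms]]
    frechet_derivative_eq_sum_pd[OF assms(2)] by simp

section \<open>Closure properties of smooth maps\<close>

lemma Ck_on_imp_continuous_on: "Ck_on r S u \<Longrightarrow> continuous_on S u"
  by (cases r) (auto simp: continuous_at_imp_continuous_on differentiable_imp_continuous_within)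

lemma Ck_on_pred: "Ck_on (Suc r) S u \<Longrightarrow> Ck_on r S u"
  by (induction r arbitrary: u)
    (use Ck_on_imp_continuous_on[of "Suc 0"] in auto)

text \<open>Openness matters because the partial derivatives involved are two-sided ones in the
  ambient space.\<close>

lemma Ck_on_cong:
  assumes "open S" "\<And>x. x \<in> S \<Longrightarrow> u x = v x"
  shows "Ck_on r S u \<longleftrightarrow> Ck_on r S v"
  using assms(2)
proof (induction r arbitrary: u v)
  case 0
  then show ?case by (simp cong: continuous_on_cong)
next
  case (Suc r)
  have "Ck_on r S (pd k u) \<longleftrightarrow> Ck_on r S (pd k v)" for k
    by (rule Suc.IH) (rule pd_cong_open[OF assms(1) _ Suc.prems])
  moreover have "u differentiable at x \<longleftrightarrow> v differentiable at x" if "x \<in> S" for x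
    by (rule differentiable_cong_open[OF assms(1) that Suc.prems])
  ultimately show ?case by simp
qed

lemma Ck_on_const [simp]: "Ck_on r S (\<lambda>x. c)"
proof (induction r arbitrary: c)
  case (Suc r)
  have "pd k (\<lambda>x. c) = (\<lambda>x. 0)" for k :: 'a by (rule ext) simp
  then show ?case using Suc by simp
qed simp

lemma Ck_on_add:
  assumes "open S"
  shows "Ck_on r S u \<Longrightarrow> Ck_on r S v \<Longrightarrow> Ck_on r S (\<lambda>x. u x + v x)"
proof (induction r arbitrary: u v)
  case (Suc r)
  have "Ck_on r S (pd k (\<lambda>x. u x + v x))" for k
    using Suc by (subst Ck_on_cong[OF assms, where v = "\<lambda>x. pd k u x + pd k v x"]) (auto simp: pd_add)
  then show ?case using Suc.prems by (auto intro: differentiable_add)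
qed (simp add: continuous_on_add)

lemma Ck_on_sum:
  assumes "open S" "\<And>i. i \<in> I \<Longrightarrow> Ck_on r S (u i)"
  shows "Ck_on r S (\<lambda>x. \<Sum>i\<in>I. u i x)"
proof (cases "finite I")
  case True
  then show ?thesis using assms(2)
    by (induction I rule: finite_induct) (auto intro!: Ck_on_add[OF assms(1)])
qed simp

lemma Ck_on_bounded_linear:
  assumes "open S" "bounded_linear L"
  shows "Ck_on r S u \<Longrightarrow> Ck_on r S (\<lambda>x. L (u x))"
proof (induction r arbitrary: u)
  case 0
  then show ?case by (simp add: bounded_linear.continuous_on[OF assms(2)])
next
  case (Suc r)
  have "Ck_on r S (pd k (\<lambda>x. L (u x)))" for k
    using Suc by (subst Ck_on_cong[OF assms(1), where v = "\<lambda>x. L (pd k u x)"])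
      (auto simp: pd_bounded_linear[OF assms(2)])
  then show ?case using Suc.prems by (auto intro: differentiable_bounded_linear[OF assms(2)])
qed

lemma Ck_on_mult:
  fixes u v :: "real^'n::finite \<Rightarrow> real"
  assumes "open S"
  shows "Ck_on r S u \<Longrightarrow> Ck_on r S v \<Longrightarrow> Ck_on r S (\<lambda>x. u x * v x)"
proof (induction r arbitrary: u v)
  case (Suc r)
  have "Ck_on r S (\<lambda>x. pd k u x * v x + u x * pd k v x)" for k
    using Suc.prems Ck_on_pred[OF Suc.prems(1)] Ck_on_pred[OF Suc.prems(2)]
    by (intro Ck_on_add[OF assms] Suc.IH) auto
  then have "Ck_on r S (pd k (\<lambda>x. u x * v x))" for k
    using Suc.prems
    by (subst Ck_on_cong[OF assms, where v = "\<lambda>x. pd k u x * v x + u x * pd k v x"]) (auto simp: pd_mult)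
  then show ?case using Suc.prems by (auto intro: differentiable_mult)
qed (simp add: continuous_on_mult)

text \<open>The derivative of \<open>1/u\<close> is a product of \<open>C\<^sup>r\<close>
  functions, two of them the function \<open>1/u\<close> itself, so the induction on \<open>r\<close> closes up.\<close>

lemma Ck_on_inverse:
  fixes u :: "real^'n::finite \<Rightarrow> real"
  assumes "open S" "\<And>x. x \<in> S \<Longrightarrow> u x \<noteq> 0"
  shows "Ck_on r S u \<Longrightarrow> Ck_on r S (\<lambda>x. inverse (u x))"
proof (induction r)
  case 0
  then show ?case using assms(2) by (simp add: continuous_on_inverse)
next
  case (Suc r)
  let ?w = "\<lambda>k x. (- 1) * (pd k u x * (inverse (u x) * inverse (u x)))"
  have "Ck_on r S (?w k)" for k
    using Suc.prems Suc.IH[OF Ck_on_pred[OF Suc.prems]]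
    by (intro Ck_on_mult[OF assms(1)]) auto
  then have "Ck_on r S (pd k (\<lambda>x. inverse (u x)))" for k
    using Suc.prems assms(2)
    by (subst Ck_on_cong[OF assms(1), where v = "?w k"]) (auto simp: pd_inverse)
  then show ?case using Suc.prems assms(2) by (auto intro: differentiable_inverse)
qed

text \<open>Composition with linear maps suffices throughout: the only inner maps that occur are
  the projections of a product chart onto the coordinates of its factors.\<close>

lemma Ck_on_compose_linear:
  fixes u :: "real^'a::finite \<Rightarrow> 'b::real_normed_vector" and L :: "real^'c::finite \<Rightarrow> real^'a"
  assumes "open T" "bounded_linear L" "L ` T \<subseteq> S"
  shows "Ck_on r S u \<Longrightarrow> Ck_on r T (\<lambda>z. u (L z))"
proof (induction r arbitrary: u)
  case 0
  then show ?case
    using continuous_on_compose2[of S u T L] assms(2,3)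
    by (simp add: linear_continuous_on)
next
  case (Suc r)
  let ?w = "\<lambda>k z. \<Sum>j\<in>UNIV. L (axis k 1) $ j *\<^sub>R pd j u (L z)"
  have "Ck_on r T (?w k)" for k
    using Suc by (intro Ck_on_sum[OF assms(1)] Ck_on_bounded_linear[OF assms(1) bounded_linear_scaleR_right]) auto
  then have "Ck_on r T (pd k (\<lambda>z. u (L z)))" for k
    using Suc.prems assms(3)
    by (subst Ck_on_cong[OF assms(1), where v = "?w k"]) (auto simp: pd_compose_linear[OF assms(2)])
  moreover have "(\<lambda>z. u (L z)) differentiable at z" if "z \<in> T" for z
    using differentiableI[OF has_derivative_compose_linear[OF assms(2), of u z]]
      Suc.prems assms(3) that by auto
  ultimately show ?case by simp
qed

lemma Ck_on_vec:
  fixes u :: "real^'n::finite \<Rightarrow> 'b::real_normed_vector^'k::finite"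
  assumes "open S" "\<And>i. Ck_on r S (\<lambda>x. u x $ i)"
  shows "Ck_on r S u"
proof -
  have *: "u x = (\<Sum>i\<in>UNIV. axis i (u x $ i))" for x
    by (simp add: vec_eq_iff axis_def if_distrib[of "\<lambda>z. z $ _"] cong: if_cong)
  have lin: "bounded_linear (axis i :: 'b \<Rightarrow> 'b^'k)" for i
  proof (rule bounded_linear_intro[of _ 1])
    fix x :: 'b
    have "(norm (axis i x $ j))\<^sup>2 = (if j = i then (norm x)\<^sup>2 else 0)" for j :: 'k
      by (simp add: axis_def)
    then show "norm (axis i x :: 'b^'k) \<le> norm x * 1"
      by (simp add: norm_vec_def L2_set_def)
  qed (auto simp: vec_eq_iff axis_def)
  have "Ck_on r S (\<lambda>x. \<Sum>i\<in>UNIV. axis i (u x $ i))"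
    by (intro Ck_on_sum[OF assms(1)] Ck_on_bounded_linear[OF assms(1) lin] assms(2))
  then show ?thesis using * by simp
qed

lemma smooth_on_cong:
  "open S \<Longrightarrow> (\<And>x. x \<in> S \<Longrightarrow> u x = v x) \<Longrightarrow> smooth_on S u \<longleftrightarrow> smooth_on S v"
  unfolding smooth_on_def using Ck_on_cong by blast

lemma smooth_on_differentiable: "smooth_on S u \<Longrightarrow> x \<in> S \<Longrightarrow> u differentiable at x"
  unfolding smooth_on_def by (metis Ck_on.simps(2))

lemma smooth_on_pd: "smooth_on S u \<Longrightarrow> smooth_on S (pd k u)"
  unfolding smooth_on_def by (metis Ck_on.simps(2))

lemma smooth_on_const [simp]: "smooth_on S (\<lambda>x. c)"
  by (simp add: smooth_on_def)

lemma smooth_on_mult: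
  fixes u v :: "real^'n::finite \<Rightarrow> real"
  shows "open S \<Longrightarrow> smooth_on S u \<Longrightarrow> smooth_on S v \<Longrightarrow> smooth_on S (\<lambda>x. u x * v x)"
  by (simp add: smooth_on_def Ck_on_mult)

lemma smooth_on_add:
  "open S \<Longrightarrow> smooth_on S u \<Longrightarrow> smooth_on S v \<Longrightarrow> smooth_on S (\<lambda>x. u x + v x)"
  by (simp add: smooth_on_def Ck_on_add)

lemma smooth_on_sum:
  "open S \<Longrightarrow> (\<And>i. i \<in> I \<Longrightarrow> smooth_on S (u i)) \<Longrightarrow> smooth_on S (\<lambda>x. \<Sum>i\<in>I. u i x)"
  by (simp add: smooth_on_def Ck_on_sum)

lemma smooth_on_cmult:
  fixes u :: "real^'n::finite \<Rightarrow> real"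
  shows "open S \<Longrightarrow> smooth_on S u \<Longrightarrow> smooth_on S (\<lambda>x. c * u x)"
  by (rule smooth_on_mult) auto

lemma smooth_on_diff:
  fixes u v :: "real^'n::finite \<Rightarrow> real"
  shows "open S \<Longrightarrow> smooth_on S u \<Longrightarrow> smooth_on S v \<Longrightarrow> smooth_on S (\<lambda>x. u x - v x)"
  using smooth_on_add[of S u "\<lambda>x. (- 1) * v x"] smooth_on_cmult[of S v "- 1"] by simp

lemma smooth_on_prod:
  fixes u :: "'i \<Rightarrow> real^'n::finite \<Rightarrow> real"
  assumes "open S" "finite I" "\<And>i. i \<in> I \<Longrightarrow> smooth_on S (u i)"
  shows "smooth_on S (\<lambda>x. \<Prod>i\<in>I. u i x)"
  using assms(2,3) by (induction I rule: finite_induct) (auto intro!: smooth_on_mult[OF assms(1)])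

lemma smooth_on_inverse:
  fixes u :: "real^'n::finite \<Rightarrow> real"
  shows "open S \<Longrightarrow> (\<And>x. x \<in> S \<Longrightarrow> u x \<noteq> 0) \<Longrightarrow> smooth_on S u \<Longrightarrow> smooth_on S (\<lambda>x. inverse (u x))"
  by (simp add: smooth_on_def Ck_on_inverse)

lemma smooth_on_compose_linear:
  fixes u :: "real^'a::finite \<Rightarrow> 'b::real_normed_vector" and L :: "real^'c::finite \<Rightarrow> real^'a"
  shows "open T \<Longrightarrow> bounded_linear L \<Longrightarrow> L ` T \<subseteq> S \<Longrightarrow> smooth_on S u \<Longrightarrow> smooth_on T (\<lambda>z. u (L z))"
  unfolding smooth_on_def using Ck_on_compose_linear by blast

lemma smooth_on_vec_iff:
  fixes u :: "real^'n::finite \<Rightarrow> 'b::real_normed_vector^'k::finite"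
  assumes "open S"
  shows "smooth_on S u \<longleftrightarrow> (\<forall>i. smooth_on S (\<lambda>x. u x $ i))"
  unfolding smooth_on_def
  using Ck_on_vec[OF assms, of _ u] Ck_on_bounded_linear[OF assms bounded_linear_vec_nth, of _ u]
  by blast

lemma smooth_on_linear:
  fixes L :: "real^'c::finite \<Rightarrow> 'b::real_normed_vector"
  assumes "open S" "bounded_linear L"
  shows "smooth_on S L"
  unfolding smooth_on_def
proof
  have pd: "pd k L = (\<lambda>x. L (axis k 1))" for k
    by (rule ext) (rule pd_eqI[OF bounded_linear_imp_has_derivative[OF assms(2)]])
  show "Ck_on r S L" for r
    by (cases r) (auto simp: pd linear_continuous_on[OF assms(2)]
      bounded_linear_imp_differentiable[OF assms(2)])
qed

section \<open>Splitting coordinates and block matrices\<close>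

lemma sum_UNIV_sum:
  fixes g :: "'a::finite + 'b::finite \<Rightarrow> 'c::comm_monoid_add"
  shows "(\<Sum>k\<in>UNIV. g k) = (\<Sum>a\<in>UNIV. g (Inl a)) + (\<Sum>b\<in>UNIV. g (Inr b))"
  using sum.Plus[of "UNIV :: 'a set" "UNIV :: 'b set" g] by (simp add: comp_def)

lemma all_sum_iff: "(\<forall>k. P k) \<longleftrightarrow> (\<forall>a. P (Inl a)) \<and> (\<forall>b. P (Inr b))"
  by (metis sum.exhaust)

lemma vleft_vjoin [simp]: "vleft (vjoin x y) = x" and vright_vjoin [simp]: "vright (vjoin x y) = y"
  by (simp_all add: vleft_def vright_def vjoin_def vec_eq_iff)

lemma vjoin_vleft_vright [simp]: "vjoin (vleft z) (vright z) = z"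
  by (simp add: vleft_def vright_def vjoin_def vec_eq_iff split: sum.split)

lemma bounded_linear_vleft: "bounded_linear (vleft :: real^('n::finite + 'm::finite) \<Rightarrow> real^'n)"
  unfolding linear_conv_bounded_linear[symmetric]
  by (rule linearI) (simp_all add: vleft_def vec_eq_iff)

lemma bounded_linear_vright: "bounded_linear (vright :: real^('n::finite + 'm::finite) \<Rightarrow> real^'m)"
  unfolding linear_conv_bounded_linear[symmetric]
  by (rule linearI) (simp_all add: vright_def vec_eq_iff)

lemma bounded_linear_vjoin:
  "bounded_linear (\<lambda>(x, y). vjoin x y :: real^('n::finite + 'm::finite))"
  unfolding linear_conv_bounded_linear[symmetric]
  by (rule linearI) (auto simp: vjoin_def vec_eq_iff split: sum.split)

lemma vleft_axis [simp]: "vleft (axis (Inl a) c) = axis a c" "vleft (axis (Inr b) c) = 0"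
  and vright_axis [simp]: "vright (axis (Inl a) c) = 0" "vright (axis (Inr b) c) = axis b c"
  by (auto simp: vleft_def vright_def axis_def vec_eq_iff)

lemma differentiable_vleft:
  "u differentiable at (vleft z) \<Longrightarrow> (\<lambda>z. u (vleft z)) differentiable at z"
  by (rule differentiableI[OF has_derivative_compose_linear[OF bounded_linear_vleft]])

lemma differentiable_vright:
  "u differentiable at (vright z) \<Longrightarrow> (\<lambda>z. u (vright z)) differentiable at z"
  by (rule differentiableI[OF has_derivative_compose_linear[OF bounded_linear_vright]])

lemma pd_vleft:
  assumes "u differentiable at (vleft z)"
  shows "pd (Inl a) (\<lambda>z. u (vleft z)) z = pd a u (vleft z)"
    and "pd (Inr b) (\<lambda>z. u (vleft z)) z = 0"
  using pd_compose_linear[OF bounded_linear_vleft assms]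
    frechet_derivative_eq_sum_pd[OF assms, of "axis a 1"]
  by (simp_all add: pd_def)

lemma pd_vright:
  assumes "u differentiable at (vright z)"
  shows "pd (Inl a) (\<lambda>z. u (vright z)) z = 0"
    and "pd (Inr b) (\<lambda>z. u (vright z)) z = pd b u (vright z)"
  using pd_compose_linear[OF bounded_linear_vright assms]
    frechet_derivative_eq_sum_pd[OF assms, of "axis b 1"]
  by (simp_all add: pd_def)

text \<open>The counterpart of \<open>U \<times> V\<close> in coordinates indexed by a disjoint sum.\<close>

definition coord_prod :: "(real^'n::finite) set \<Rightarrow> (real^'m::finite) set \<Rightarrow> (real^('n + 'm)) set" where
  "coord_prod U V = {z. vleft z \<in> U \<and> vright z \<in> V}"

lemma coord_prod_eq_image: "coord_prod U V = (\<lambda>(x, y). vjoin x y) ` (U \<times> V)"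
  unfolding coord_prod_def by (force simp: image_iff)

lemma open_coord_prod: "open U \<Longrightarrow> open V \<Longrightarrow> open (coord_prod U V)"
proof -
  assume "open U" "open V"
  then have "open (vleft -` U \<inter> vright -` V :: (real^('a + 'b)) set)"
    by (intro open_Int open_vimage linear_continuous_on bounded_linear_vleft bounded_linear_vright)
  moreover have "vleft -` U \<inter> vright -` V = coord_prod U V" by (auto simp: coord_prod_def)
  ultimately show ?thesis by simp
qed

lemma smooth_on_vleft: "open U \<Longrightarrow> open V \<Longrightarrow> smooth_on U u \<Longrightarrow> smooth_on (coord_prod U V) (\<lambda>z. u (vleft z))"
  by (rule smooth_on_compose_linear[OF open_coord_prod bounded_linear_vleft]) (auto simp: coord_prod_def)

lemma smooth_on_vright: "open U \<Longrightarrow> open V \<Longrightarrow> smooth_on V u \<Longrightarrow> smooth_on (coord_prod U V) (\<lambda>z. u (vright z))"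
  by (rule smooth_on_compose_linear[OF open_coord_prod bounded_linear_vright]) (auto simp: coord_prod_def)

definition block_diag :: "real^'n^'n \<Rightarrow> real^'m^'m \<Rightarrow> real^('n::finite + 'm::finite)^('n + 'm)" where
  "block_diag A D = (\<chi> k l. case (k, l) of
     (Inl a, Inl b) \<Rightarrow> A $ a $ b | (Inr a, Inr b) \<Rightarrow> D $ a $ b | _ \<Rightarrow> 0)"

lemma block_diag_nth [simp]:
  "block_diag A D $ Inl a $ Inl b = A $ a $ b" "block_diag A D $ Inl a $ Inr d = 0"
  "block_diag A D $ Inr c $ Inl b = 0" "block_diag A D $ Inr c $ Inr d = D $ c $ d"
  by (simp_all add: block_diag_def)

lemma block_diag_eqI:
  assumes "\<And>a b. X $ Inl a $ Inl b = A $ a $ b" "\<And>a d. X $ Inl a $ Inr d = 0"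
    "\<And>c b. X $ Inr c $ Inl b = 0" "\<And>c d. X $ Inr c $ Inr d = D $ c $ d"
  shows "X = block_diag A D"
  using assms by (simp add: vec_eq_iff all_sum_iff)

lemma block_diag_mult: "block_diag A D ** block_diag A' D' = block_diag (A ** A') (D ** D')"
  by (rule block_diag_eqI) (simp_all add: matrix_matrix_mult_def sum_UNIV_sum)

lemma transpose_block_diag: "transpose (block_diag A D) = block_diag (transpose A) (transpose D)"
  by (rule block_diag_eqI) (simp_all add: transpose_def)

lemma block_diag_one: "block_diag (mat 1) (mat 1) = mat 1"
  by (rule block_diag_eqI[symmetric]) (simp_all add: mat_def)

lemma matrix_inv_mult:
  fixes A :: "real^'n::finite^'n"
  assumes "invertible A"
  shows "A ** matrix_inv A = mat 1" "matrix_inv A ** A = mat 1"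
  using someI_ex[of "\<lambda>A'. A ** A' = mat 1 \<and> A' ** A = mat 1"] assms
  unfolding invertible_def matrix_inv_def by auto

lemma matrix_inv_eqI:
  fixes A B :: "real^'n::finite^'n"
  assumes "A ** B = mat 1"
  shows "matrix_inv A = B" "invertible A"
proof -
  show inv: "invertible A"
    using assms invertible_right_inverse by blast
  have "matrix_inv A = matrix_inv A ** (A ** B)" by (simp add: assms)
  also have "\<dots> = B" by (simp add: matrix_mul_assoc matrix_inv_mult[OF inv])
  finally show "matrix_inv A = B" .
qed

lemma scaleR_matrix_mult:
  fixes A B :: "real^'n::finite^'n"
  shows "(c *\<^sub>R A) ** B = c *\<^sub>R (A ** B)" "A ** (c *\<^sub>R B) = c *\<^sub>R (A ** B)"
  by (simp_all add: matrix_matrix_mult_def vec_eq_iff sum_distrib_left mult_ac)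

lemma matrix_inv_scaleR:
  fixes A :: "real^'n::finite^'n"
  assumes "invertible A" "c \<noteq> 0"
  shows "matrix_inv (c *\<^sub>R A) = inverse c *\<^sub>R matrix_inv A" "invertible (c *\<^sub>R A)"
proof -
  have "(c *\<^sub>R A) ** (inverse c *\<^sub>R matrix_inv A) = mat 1"
    using assms by (simp add: scaleR_matrix_mult matrix_inv_mult)
  then show "matrix_inv (c *\<^sub>R A) = inverse c *\<^sub>R matrix_inv A" "invertible (c *\<^sub>R A)"
    by (rule matrix_inv_eqI)+
qed

lemma matrix_inv_block_diag:
  assumes "invertible A" "invertible D"
  shows "matrix_inv (block_diag A D) = block_diag (matrix_inv A) (matrix_inv D)"
    and "invertible (block_diag A D)"
proof -
  have "block_diag A D ** block_diag (matrix_inv A) (matrix_inv D) = mat 1"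
    using assms by (simp add: block_diag_mult matrix_inv_mult block_diag_one)
  then show "matrix_inv (block_diag A D) = block_diag (matrix_inv A) (matrix_inv D)"
    "invertible (block_diag A D)" by (rule matrix_inv_eqI)+
qed

section \<open>Charts of a manifold and of a product\<close>

lemma smooth_manifold_chart:
  assumes "smooth_manifold M" "i \<in> idx M"
  shows "inj_on (chart M i) (cdom M i)" "open (cimage M i)" "cdom M i \<subseteq> topspace (mtop M)"
    and "homeomorphic_map (subtopology (mtop M) (cdom M i)) (top_of_set (cimage M i)) (chart M i)"
proof -
  show sub: "cdom M i \<subseteq> topspace (mtop M)" and "open (cimage M i)"
    and hom: "homeomorphic_map (subtopology (mtop M) (cdom M i)) (top_of_set (cimage M i)) (chart M i)"
    using assms by (auto simp: smooth_manifold_def openin_subset)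
  have "topspace (subtopology (mtop M) (cdom M i)) = cdom M i" using sub by auto
  then show "inj_on (chart M i) (cdom M i)"
    using homeomorphic_imp_injective_map[OF hom] by simp
qed

lemma open_chart_overlap:
  assumes "smooth_manifold M" "i \<in> idx M" "j \<in> idx M"
  shows "open (chart M i ` (cdom M i \<inter> cdom M j))"
proof -
  have "openin (mtop M) (cdom M j)" using assms by (simp add: smooth_manifold_def)
  then have "openin (subtopology (mtop M) (cdom M i)) (cdom M i \<inter> cdom M j)"
    by (auto simp: openin_subtopology)
  then have "openin (top_of_set (cimage M i)) (chart M i ` (cdom M i \<inter> cdom M j))"
    using smooth_manifold_chart(4)[OF assms(1,2)] homeomorphic_imp_open_map open_map_def by blast
  then show ?thesis
    using openin_open_trans smooth_manifold_chart(2)[OF assms(1,2)] by blast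
qed

lemma loc_chart:
  assumes "inj_on (chart M i) (cdom M i)" "p \<in> cdom M i"
  shows "loc M i u (chart M i p) = u p"
  using assms by (simp add: loc_def)

text \<open>A function without zeros on the manifold has none in coordinates, so conformal and
  warping factors may be inverted in every chart.\<close>

lemma loc_nonzero:
  assumes "smooth_manifold M" "i \<in> idx M" "x \<in> cimage M i"
    and "\<And>p. p \<in> topspace (mtop M) \<Longrightarrow> u p \<noteq> (0 :: real)"
  shows "loc M i u x \<noteq> 0"
proof -
  obtain p where p: "p \<in> cdom M i" "x = chart M i p"
    using assms(3) by (auto simp: cimage_def)
  have "loc M i u x = u p"
    unfolding p(2) by (rule loc_chart[OF smooth_manifold_chart(1)[OF assms(1,2)] p(1)])
  then show ?thesis
    using assms(4) smooth_manifold_chart(3)[OF assms(1,2)] p(1) by auto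
qed

lemma Euclidean_manifold_simps [simp]:
  "mtop Euclidean_manifold = euclidean" "idx Euclidean_manifold = UNIV"
  "cdom Euclidean_manifold i = UNIV" "chart Euclidean_manifold i = (\<lambda>x. x)"
  "cimage Euclidean_manifold i = UNIV" "loc Euclidean_manifold i u = u"
proof -
  have "inv_into UNIV (\<lambda>x :: real^'a. x) = (\<lambda>x. x)"
    using inv_id unfolding id_def .
  then show "loc Euclidean_manifold i u = u"
    by (simp add: Euclidean_manifold_def loc_def fun_eq_iff)
qed (simp_all add: Euclidean_manifold_def cimage_def)

lemma second_countable_euclidean: "second_countable (euclidean :: 'a::second_countable_topology topology)"
proof -
  obtain B :: "'a set set" where B: "countable B" "topological_basis B"
    using ex_countable_basis by blast
  have "\<exists>V\<in>B. x \<in> V \<and> V \<subseteq> U" if "open U" "x \<in> U" for U x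
    using topological_basisE[OF B(2) that] by metis
  then show ?thesis
    unfolding second_countable_def using B topological_basis_open[OF B(2)]
    by (intro exI[of _ B]) simp
qed

lemma second_countable_prod_topology:
  assumes "second_countable X" "second_countable Y"
  shows "second_countable (prod_topology X Y)"
proof -
  obtain A where A: "countable A" "\<And>V. V \<in> A \<Longrightarrow> openin X V"
    "\<And>U x. openin X U \<Longrightarrow> x \<in> U \<Longrightarrow> \<exists>V \<in> A. x \<in> V \<and> V \<subseteq> U"
    using assms(1) by (auto simp: second_countable_def)
  obtain B where B: "countable B" "\<And>V. V \<in> B \<Longrightarrow> openin Y V"
    "\<And>U x. openin Y U \<Longrightarrow> x \<in> U \<Longrightarrow> \<exists>V \<in> B. x \<in> V \<and> V \<subseteq> U"
    using assms(2) by (auto simp: second_countable_def)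
  let ?C = "(\<lambda>(V, W). V \<times> W) ` (A \<times> B)"
  have "\<exists>W\<in>?C. z \<in> W \<and> W \<subseteq> U" if openU: "openin (prod_topology X Y) U" and zU: "z \<in> U" for U z
  proof -
    obtain x y where z: "z = (x, y)" by fastforce
    obtain U1 U2 where U: "openin X U1" "openin Y U2" "x \<in> U1" "y \<in> U2" "U1 \<times> U2 \<subseteq> U"
      using openU[unfolded openin_prod_topology_alt, rule_format, OF zU[unfolded z]] by blast
    obtain V W where "V \<in> A" "x \<in> V" "V \<subseteq> U1" "W \<in> B" "y \<in> W" "W \<subseteq> U2"
      using A(3)[OF U(1,3)] B(3)[OF U(2,4)] by blast
    then show ?thesis using U(5) z by (intro bexI[of _ "V \<times> W"]) auto
  qed
  then have "\<forall>U z. openin (prod_topology X Y) U \<and> z \<in> U \<longrightarrow> (\<exists>W\<in>?C. z \<in> W \<and> W \<subseteq> U)"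
    by (intro allI impI) (elim conjE)
  moreover have "countable ?C" using A(1) B(1) by simp
  moreover have "\<forall>W\<in>?C. openin (prod_topology X Y) W"
    using A(2) B(2) by (auto simp: openin_prod_Times_iff)
  ultimately show ?thesis
    unfolding second_countable_def by (intro exI[of _ ?C] conjI)
qed

lemma smooth_manifold_Euclidean: "smooth_manifold Euclidean_manifold"
  unfolding smooth_manifold_def
  by (auto simp: second_countable_euclidean Hausdorff_space_euclidean homeomorphic_map_id[unfolded id_def]
      intro!: smooth_on_linear bounded_linear_ident)

lemma product_manifold_simps [simp]:
  "mtop (product_manifold B F) = prod_topology (mtop B) (mtop F)"
  "idx (product_manifold B F) = idx B \<times> idx F"
  "cdom (product_manifold B F) (i, j) = cdom B i \<times> cdom F j"
  "chart (product_manifold B F) (i, j) = (\<lambda>(p, q). vjoin (chart B i p) (chart F j q))"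
  by (simp_all add: product_manifold_def)

lemma chart_product_image:
  "chart (product_manifold B F) (i, j) ` (P \<times> Q) = coord_prod (chart B i ` P) (chart F j ` Q)"
  unfolding coord_prod_eq_image by (force simp: image_iff)

lemma cimage_product: "cimage (product_manifold B F) (i, j) = coord_prod (cimage B i) (cimage F j)"
  using chart_product_image[of B F i j "cdom B i" "cdom F j"] by (simp add: cimage_def)

lemma loc_product:
  assumes "inj_on (chart B i) (cdom B i)" "inj_on (chart F j) (cdom F j)"
    and "z \<in> coord_prod (cimage B i) (cimage F j)"
  shows "loc (product_manifold B F) (i, j) u z
    = u (inv_into (cdom B i) (chart B i) (vleft z), inv_into (cdom F j) (chart F j) (vright z))"
proof -
  obtain p q where pq: "p \<in> cdom B i" "q \<in> cdom F j" "vleft z = chart B i p" "vright z = chart F j q"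
    using assms(3) by (auto simp: coord_prod_def cimage_def)
  have inj: "inj_on (\<lambda>(p, q). vjoin (chart B i p) (chart F j q)) (cdom B i \<times> cdom F j)"
  proof (rule inj_onI, clarify)
    fix p q p' q' assume "p \<in> cdom B i" "q \<in> cdom F j" "p' \<in> cdom B i" "q' \<in> cdom F j"
      and eq: "vjoin (chart B i p) (chart F j q) = vjoin (chart B i p') (chart F j q')"
    moreover have "chart B i p = chart B i p'" "chart F j q = chart F j q'"
      using arg_cong[OF eq, of vleft] arg_cong[OF eq, of vright] by simp_all
    ultimately show "p = p' \<and> q = q'"
      using inj_onD[OF assms(1)] inj_onD[OF assms(2)] by blast
  qed
  have z: "vjoin (chart B i p) (chart F j q) = z"
    by (simp flip: pq(3,4))
  have "inv_into (cdom B i \<times> cdom F j) (\<lambda>(p, q). vjoin (chart B i p) (chart F j q)) z = (p, q)"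
    using inv_into_f_f[OF inj, of "(p, q)"] pq(1,2) by (simp add: z)
  then show ?thesis
    using pq assms(1,2) by (simp add: loc_def)
qed

lemma loc_product_fst:
  assumes "inj_on (chart B i) (cdom B i)" "inj_on (chart F j) (cdom F j)"
    and "z \<in> coord_prod (cimage B i) (cimage F j)"
  shows "loc (product_manifold B F) (i, j) (u \<circ> fst) z = loc B i u (vleft z)"
  unfolding loc_product[OF assms] by (simp add: loc_def)

lemma homeomorphic_map_vjoin:
  "homeomorphic_map (top_of_set (U \<times> V)) (top_of_set (coord_prod U V)) (\<lambda>(x, y). vjoin x y)"
proof -
  have "homeomorphic_maps (top_of_set (U \<times> V)) (top_of_set (coord_prod U V))
      (\<lambda>(x, y). vjoin x y) (\<lambda>z. (vleft z, vright z))"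
    unfolding homeomorphic_maps_def
    by (auto simp: coord_prod_def linear_continuous_on[OF bounded_linear_vjoin]
        intro!: continuous_on_Pair linear_continuous_on[OF bounded_linear_vleft]
          linear_continuous_on[OF bounded_linear_vright])
  then show ?thesis using homeomorphic_map_maps by blast
qed

lemma smooth_on_vjoin:
  assumes "open U" "open V" "smooth_on U u" "smooth_on V v"
  shows "smooth_on (coord_prod U V) (\<lambda>z. vjoin (u (vleft z)) (v (vright z)))"
  unfolding smooth_on_vec_iff[OF open_coord_prod[OF assms(1,2)]] all_sum_iff
  using assms(3,4) smooth_on_vleft[OF assms(1,2), of "\<lambda>x. u x $ _"]
    smooth_on_vright[OF assms(1,2), of "\<lambda>y. v y $ _"]
  by (simp add: vjoin_def smooth_on_vec_iff[OF assms(1)] smooth_on_vec_iff[OF assms(2)])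

text \<open>Transition maps of a product act on the two groups of coordinates separately, so every
  condition on an atlas is inherited factor by factor.\<close>

lemma transition_product:
  assumes "inj_on (chart B i) (cdom B i)" "inj_on (chart F j) (cdom F j)"
    and "z \<in> coord_prod (cimage B i) (cimage F j)"
  shows "loc (product_manifold B F) (i, j) (chart (product_manifold B F) (i', j')) z
    = vjoin (loc B i (chart B i') (vleft z)) (loc F j (chart F j') (vright z))"
  unfolding loc_product[OF assms] by (simp add: loc_def)

text \<open>The chart of the product is the product of the charts followed by the linear
  homeomorphism that joins coordinates.\<close>

lemma smooth_manifold_product:
  assumes B: "smooth_manifold B" and F: "smooth_manifold F"
  shows "smooth_manifold (product_manifold B F)"
  unfolding smooth_manifold_def
proof (intro conjI)
  let ?P = "product_manifold B F"
  show "Hausdorff_space (mtop ?P)" "second_countable (mtop ?P)"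
    using B F by (auto simp: smooth_manifold_def Hausdorff_space_prod_topology second_countable_prod_topology)
  show "topspace (mtop ?P) \<noteq> {}"
    using B F by (auto simp: smooth_manifold_def)
  have cover: "(\<Union>i\<in>idx B. cdom B i) = topspace (mtop B)" "(\<Union>j\<in>idx F. cdom F j) = topspace (mtop F)"
    using B F by (simp_all add: smooth_manifold_def)
  show "(\<Union>k\<in>idx ?P. cdom ?P k) = topspace (mtop ?P)"
    by (auto simp flip: cover)
  show "\<forall>k\<in>idx ?P. openin (mtop ?P) (cdom ?P k) \<and> open (cimage ?P k) \<and>
      homeomorphic_map (subtopology (mtop ?P) (cdom ?P k)) (top_of_set (cimage ?P k)) (chart ?P k)"
  proof (clarsimp simp del: product_manifold_simps(4), intro conjI)
    fix i j assume i: "i \<in> idx B" and j: "j \<in> idx F"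
    note cB = smooth_manifold_chart[OF B i] and cF = smooth_manifold_chart[OF F j]
    show "openin (prod_topology (mtop B) (mtop F)) (cdom B i \<times> cdom F j)"
      using i j B F by (auto simp: smooth_manifold_def openin_prod_Times_iff)
    show "open (cimage ?P (i, j))"
      unfolding cimage_product by (rule open_coord_prod[OF cB(2) cF(2)])
    obtain bi fj where
      "homeomorphic_maps (subtopology (mtop B) (cdom B i)) (top_of_set (cimage B i)) (chart B i) bi"
      "homeomorphic_maps (subtopology (mtop F) (cdom F j)) (top_of_set (cimage F j)) (chart F j) fj"
      using cB(4) cF(4) unfolding homeomorphic_map_maps by blast
    then have "homeomorphic_map
        (prod_topology (subtopology (mtop B) (cdom B i)) (subtopology (mtop F) (cdom F j)))
        (prod_topology (top_of_set (cimage B i)) (top_of_set (cimage F j)))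
        (\<lambda>(p, q). (chart B i p, chart F j q))"
      unfolding homeomorphic_map_maps using homeomorphic_maps_prod by blast
    then have "homeomorphic_map
        (subtopology (prod_topology (mtop B) (mtop F)) (cdom B i \<times> cdom F j))
        (top_of_set (cimage B i \<times> cimage F j)) (\<lambda>(p, q). (chart B i p, chart F j q))"
      by (simp add: subtopology_Times)
    from homeomorphic_map_compose[OF this homeomorphic_map_vjoin]
    have "homeomorphic_map
        (subtopology (prod_topology (mtop B) (mtop F)) (cdom B i \<times> cdom F j))
        (top_of_set (coord_prod (cimage B i) (cimage F j)))
        ((\<lambda>(x, y). vjoin x y) \<circ> (\<lambda>(p, q). (chart B i p, chart F j q)))" .
    moreover have "(\<lambda>(x, y). vjoin x y) \<circ> (\<lambda>(p, q). (chart B i p, chart F j q)) = chart ?P (i, j)"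
      by auto
    ultimately show "homeomorphic_map
        (subtopology (prod_topology (mtop B) (mtop F)) (cdom B i \<times> cdom F j))
        (top_of_set (cimage ?P (i, j))) (chart ?P (i, j))"
      by (simp add: cimage_product)
  qed
  show "\<forall>k\<in>idx ?P. \<forall>l\<in>idx ?P. smooth_on (chart ?P k ` (cdom ?P k \<inter> cdom ?P l)) (loc ?P k (chart ?P l))"
  proof (clarsimp simp del: product_manifold_simps(4))
    fix i j i' j' assume i: "i \<in> idx B" "i' \<in> idx B" and j: "j \<in> idx F" "j' \<in> idx F"
    let ?U = "chart B i ` (cdom B i \<inter> cdom B i')" and ?V = "chart F j ` (cdom F j \<inter> cdom F j')"
    have U: "open ?U" and V: "open ?V"
      using open_chart_overlap[OF B i] open_chart_overlap[OF F j] by auto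
    have "smooth_on ?U (loc B i (chart B i'))" "smooth_on ?V (loc F j (chart F j'))"
      using B F i j unfolding smooth_manifold_def by blast+
    note s = smooth_on_vjoin[OF U V this]
    have "coord_prod ?U ?V \<subseteq> coord_prod (cimage B i) (cimage F j)"
      by (auto simp: coord_prod_def cimage_def)
    then have eq: "loc ?P (i, j) (chart ?P (i', j')) z
        = vjoin (loc B i (chart B i') (vleft z)) (loc F j (chart F j') (vright z))"
      if "z \<in> coord_prod ?U ?V" for z
      using that transition_product[OF smooth_manifold_chart(1)[OF B i(1)] smooth_manifold_chart(1)[OF F j(1)]]
      by blast
    have "smooth_on (coord_prod ?U ?V) (loc ?P (i, j) (chart ?P (i', j')))"
      by (rule smooth_on_cong[OF open_coord_prod[OF U V], THEN iffD2, OF _ s]) (rule eq)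
    then show "smooth_on (chart ?P (i, j) ` (cdom B i \<times> cdom F j \<inter> cdom B i' \<times> cdom F j'))
        (loc ?P (i, j) (chart ?P (i', j')))"
      by (simp only: Times_Int_Times chart_product_image)
  qed
qed

lemma smooth_function_fst:
  assumes B: "smooth_manifold B" and F: "smooth_manifold F" and u: "smooth_function B u"
  shows "smooth_function (product_manifold B F) (u \<circ> fst)"
  unfolding smooth_function_def
proof (clarsimp simp: cimage_product)
  fix i j assume i: "i \<in> idx B" and j: "j \<in> idx F"
  note cB = smooth_manifold_chart[OF B i] and cF = smooth_manifold_chart[OF F j]
  have "smooth_on (coord_prod (cimage B i) (cimage F j)) (\<lambda>z. loc B i u (vleft z))"
    using u i smooth_on_vleft[OF cB(2) cF(2), of "loc B i u"] by (simp add: smooth_function_def)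
  then show "smooth_on (coord_prod (cimage B i) (cimage F j)) (loc (product_manifold B F) (i, j) (u \<circ> fst))"
    by (rule smooth_on_cong[OF open_coord_prod[OF cB(2) cF(2)], THEN iffD2, rotated])
      (rule loc_product_fst[OF cB(1) cF(1)])
qed

section \<open>Conformal changes and warped products are metrics\<close>

lemma jacobian_eq_pd: "jacobian u (at x) = (\<chi> i j. pd j u x $ i)"
  by (simp add: jacobian_def matrix_def pd_def)

text \<open>Stated for a map \<open>T\<close> that splits only near \<open>z\<close>, since the
  coordinate expression of a transition map is meaningful only on the chart overlap.\<close>

lemma jacobian_product:
  assumes "open S" "z \<in> S" "\<And>w. w \<in> S \<Longrightarrow> T w = vjoin (u (vleft w)) (v (vright w))"
    and u: "u differentiable at (vleft z)" and v: "v differentiable at (vright z)"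
  shows "jacobian T (at z) = block_diag (jacobian u (at (vleft z))) (jacobian v (at (vright z)))"
proof -
  have "T differentiable at z"
  proof -
    have "(\<lambda>w. (\<lambda>(x, y). vjoin x y) (u (vleft w), v (vright w))) differentiable at z"
      using has_derivative_Pair[OF differentiable_vleft[OF u, THEN has_derivative_frechet]
          differentiable_vright[OF v, THEN has_derivative_frechet]]
      by (intro differentiable_bounded_linear[OF bounded_linear_vjoin]) (rule differentiableI)
    then show ?thesis
      using assms(3) by (subst differentiable_cong_open[OF assms(1,2)]) auto
  qed
  then have T: "pd k T z $ l = pd k (\<lambda>w. vjoin (u (vleft w)) (v (vright w)) $ l) z" for k l
    using pd_nth[of T z k l] pd_cong_open[OF assms(1,2), of "\<lambda>w. T w $ l" "\<lambda>w. vjoin (u (vleft w)) (v (vright w)) $ l" k]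
      assms(3) by auto
  show ?thesis
    unfolding jacobian_eq_pd
    by (rule block_diag_eqI)
      (simp_all add: T vjoin_def pd_vleft[OF differentiable_nth[OF u]] pd_vright[OF differentiable_nth[OF v]]
        pd_nth u v)
qed

lemma pseudo_RiemannianD:
  assumes "pseudo_Riemannian M g" "i \<in> idx M"
  shows "smooth_on (cimage M i) (g i)"
    and "x \<in> cimage M i \<Longrightarrow> transpose (g i x) = g i x"
    and "x \<in> cimage M i \<Longrightarrow> invertible (g i x)"
  using assms unfolding pseudo_Riemannian_def by blast+

lemma metric_transformation:
  assumes "pseudo_Riemannian M g" "i \<in> idx M" "j \<in> idx M" "p \<in> cdom M i \<inter> cdom M j"
  shows "g i (chart M i p) = transpose (jacobian (loc M i (chart M j)) (at (chart M i p)))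
    ** g j (chart M j p) ** jacobian (loc M i (chart M j)) (at (chart M i p))"
  using assms unfolding pseudo_Riemannian_def Let_def by blast

lemma sign_matrix_square:
  assumes "\<And>i. \<epsilon> i \<in> {-1, 1 :: real}"
  shows "(\<chi> i j. if i = j then \<epsilon> i else 0) ** (\<chi> i j. if i = j then \<epsilon> i else 0)
    = (mat 1 :: real^'n::finite^'n)"
proof -
  have "\<epsilon> i * \<epsilon> i = 1" for i using assms[of i] by auto
  then have "(if i = k then \<epsilon> i else 0) * (if k = j then \<epsilon> k else 0)
      = (if k = i then (if i = j then 1 else 0) else 0)" for i j k by auto
  then show ?thesis
    by (simp add: matrix_matrix_mult_def mat_def vec_eq_iff)
qed

lemma pseudo_Riemannian_pseudo_Euclidean:
  assumes "\<And>i. \<epsilon> i \<in> {-1, 1 :: real}"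
  shows "pseudo_Riemannian Euclidean_manifold (pseudo_Euclidean_metric \<epsilon>)"
proof -
  let ?E = "\<chi> i j. if i = j then \<epsilon> i else 0"
  have "invertible ?E" by (rule matrix_inv_eqI[OF sign_matrix_square[OF assms]])
  moreover have "transpose ?E = ?E" by (auto simp: transpose_def vec_eq_iff)
  moreover have "jacobian (\<lambda>x :: real^'a. x) (at x) = mat 1" for x
    using pd_eqI[OF has_derivative_ident, of _ x]
    by (simp add: jacobian_eq_pd mat_def vec_eq_iff axis_def)
  ultimately show ?thesis
    unfolding pseudo_Riemannian_def pseudo_Euclidean_metric_def
    by (simp add: smooth_manifold_Euclidean)
qed

lemma pseudo_Riemannian_conformal:
  assumes g: "pseudo_Riemannian M g" and \<phi>: "smooth_function M \<phi>"
    and nz: "\<And>p. p \<in> topspace (mtop M) \<Longrightarrow> \<phi> p \<noteq> 0"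
  shows "pseudo_Riemannian M (conformal_metric M \<phi> g)"
proof -
  have M: "smooth_manifold M" using g by (simp add: pseudo_Riemannian_def)
  note c = smooth_manifold_chart[OF M]
  have nz': "loc M i \<phi> x \<noteq> 0" if "i \<in> idx M" "x \<in> cimage M i" for i x
    by (rule loc_nonzero[OF M that nz])
  show ?thesis
    unfolding pseudo_Riemannian_def conformal_metric_def
  proof (intro conjI ballI)
    show "smooth_manifold M" by (fact M)
    fix i assume i: "i \<in> idx M"
    have gi: "smooth_on (cimage M i) (g i)" "smooth_on (cimage M i) (loc M i \<phi>)"
      using pseudo_RiemannianD(1)[OF g i] \<phi> i by (auto simp: smooth_function_def)
    then show "smooth_on (cimage M i) (\<lambda>x. (1 / (loc M i \<phi> x)\<^sup>2) *\<^sub>R g i x)"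
      using nz'[OF i]
      by (auto simp: smooth_on_vec_iff[OF c(2)[OF i]] divide_inverse power2_eq_square
          intro!: smooth_on_mult smooth_on_inverse c(2)[OF i])
    show "transpose ((1 / (loc M i \<phi> x)\<^sup>2) *\<^sub>R g i x) = (1 / (loc M i \<phi> x)\<^sup>2) *\<^sub>R g i x"
      "invertible ((1 / (loc M i \<phi> x)\<^sup>2) *\<^sub>R g i x)" if "x \<in> cimage M i" for x
    proof -
      have "transpose (g i x) = g i x" "invertible (g i x)"
        using pseudo_RiemannianD[OF g i] that by auto
      then show "transpose ((1 / (loc M i \<phi> x)\<^sup>2) *\<^sub>R g i x) = (1 / (loc M i \<phi> x)\<^sup>2) *\<^sub>R g i x"
        "invertible ((1 / (loc M i \<phi> x)\<^sup>2) *\<^sub>R g i x)"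
        using nz'[OF i that] by (auto intro!: matrix_inv_scaleR(2) simp: transpose_def vec_eq_iff)
    qed
    fix j p assume j: "j \<in> idx M" and p: "p \<in> cdom M i \<inter> cdom M j"
    define J where "J = jacobian (loc M i (chart M j)) (at (chart M i p))"
    have "g i (chart M i p) = transpose J ** g j (chart M j p) ** J"
      unfolding J_def by (rule metric_transformation[OF g i j p])
    moreover have "loc M i \<phi> (chart M i p) = \<phi> p" "loc M j \<phi> (chart M j p) = \<phi> p"
      using p loc_chart[OF c(1)[OF i]] loc_chart[OF c(1)[OF j]] by auto
    ultimately show "let J = jacobian (loc M i (chart M j)) (at (chart M i p))
        in (1 / (loc M i \<phi> (chart M i p))\<^sup>2) *\<^sub>R g i (chart M i p)
          = transpose J ** ((1 / (loc M j \<phi> (chart M j p))\<^sup>2) *\<^sub>R g j (chart M j p)) ** J"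
      unfolding J_def[symmetric] Let_def by (simp add: scaleR_matrix_mult)
  qed
qed

text \<open>The warped metric in one chart, freed from the manifolds so that its curvature
  can be computed on an open set of coordinates.\<close>

definition warped_coords ::
    "(real^'n::finite \<Rightarrow> real^'n^'n) \<Rightarrow> (real^'n \<Rightarrow> real) \<Rightarrow> (real^'m::finite \<Rightarrow> real^'m^'m)
      \<Rightarrow> real^('n + 'm) \<Rightarrow> real^('n + 'm)^('n + 'm)" where
  "warped_coords G f H z = block_diag (G (vleft z)) ((f (vleft z))\<^sup>2 *\<^sub>R H (vright z))"

lemma warped_metric_eq: "warped_metric B gB f gF (i, j) = warped_coords (gB i) (loc B i f) (gF j)"
  unfolding warped_metric_def warped_coords_def
  by (rule ext) (rule block_diag_eqI, simp_all)

lemma smooth_on_warped_coords: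
  assumes "open U" "open V" "smooth_on U G" "smooth_on U f" "smooth_on V H"
  shows "smooth_on (coord_prod U V) (warped_coords G f H)"
proof -
  have G: "smooth_on U (\<lambda>x. G x $ a $ b)" for a b
    using assms(3) by (simp add: smooth_on_vec_iff[OF assms(1)])
  have H: "smooth_on V (\<lambda>x. H x $ a $ b)" for a b
    using assms(5) by (simp add: smooth_on_vec_iff[OF assms(2)])
  show ?thesis
    unfolding smooth_on_vec_iff[OF open_coord_prod[OF assms(1,2)]] all_sum_iff
    by (auto simp: warped_coords_def power2_eq_square smooth_on_vleft[OF assms(1,2) G]
        intro!: smooth_on_mult open_coord_prod assms(1,2) smooth_on_vleft[OF assms(1,2) assms(4)]
          smooth_on_vright[OF assms(1,2) H])
qed

text \<open>With block diagonal Jacobians the tensor law for the warped metric is the law for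
  the two factors, block by block; the factor \<open>f\<^sup>2\<close> is a function on \<open>B\<close>
  and has the same value in both charts.\<close>

lemma pseudo_Riemannian_warped:
  assumes gB: "pseudo_Riemannian B gB" and gF: "pseudo_Riemannian F gF"
    and f: "smooth_function B f" and nz: "\<And>p. p \<in> topspace (mtop B) \<Longrightarrow> f p \<noteq> 0"
  shows "pseudo_Riemannian (product_manifold B F) (warped_metric B gB f gF)"
proof -
  let ?P = "product_manifold B F"
  have B: "smooth_manifold B" and F: "smooth_manifold F"
    using gB gF by (auto simp: pseudo_Riemannian_def)
  note cB = smooth_manifold_chart[OF B] and cF = smooth_manifold_chart[OF F]
  have nz': "loc B i f x \<noteq> 0" if "i \<in> idx B" "x \<in> cimage B i" for i x
    by (rule loc_nonzero[OF B that nz])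
  show ?thesis
    unfolding pseudo_Riemannian_def
  proof (intro conjI ballI)
    show "smooth_manifold ?P" by (rule smooth_manifold_product[OF B F])
    fix k assume "k \<in> idx ?P"
    then obtain i j where k: "k = (i, j)" "i \<in> idx B" "j \<in> idx F" by auto
    show "smooth_on (cimage ?P k) (warped_metric B gB f gF k)"
      unfolding k(1) warped_metric_eq cimage_product
      using f k
      by (intro smooth_on_warped_coords cB(2) cF(2) pseudo_RiemannianD(1)[OF gB] pseudo_RiemannianD(1)[OF gF])
        (auto simp: smooth_function_def)
    show "transpose (warped_metric B gB f gF k z) = warped_metric B gB f gF k z"
      "invertible (warped_metric B gB f gF k z)" if "z \<in> cimage ?P k" for z
    proof -
      have z: "vleft z \<in> cimage B i" "vright z \<in> cimage F j"
        using that by (auto simp: k(1) cimage_product coord_prod_def)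
      then have "transpose (gB i (vleft z)) = gB i (vleft z)" "invertible (gB i (vleft z))"
        "transpose (gF j (vright z)) = gF j (vright z)" "invertible (gF j (vright z))"
        using pseudo_RiemannianD[OF gB k(2)] pseudo_RiemannianD[OF gF k(3)] by auto
      moreover from this have "transpose ((loc B i f (vleft z))\<^sup>2 *\<^sub>R gF j (vright z))
          = (loc B i f (vleft z))\<^sup>2 *\<^sub>R gF j (vright z)"
        by (simp add: transpose_def vec_eq_iff)
      ultimately show "transpose (warped_metric B gB f gF k z) = warped_metric B gB f gF k z"
        "invertible (warped_metric B gB f gF k z)"
        using nz'[OF k(2) z(1)] unfolding k(1) warped_metric_eq warped_coords_def
        by (auto simp: transpose_block_diag intro!: matrix_inv_block_diag(2) matrix_inv_scaleR(2))
    qed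
    fix l p assume "l \<in> idx ?P" and p: "p \<in> cdom ?P k \<inter> cdom ?P l"
    then obtain i' j' where l: "l = (i', j')" "i' \<in> idx B" "j' \<in> idx F" by auto
    obtain p1 p2 where p12: "p = (p1, p2)" "p1 \<in> cdom B i \<inter> cdom B i'" "p2 \<in> cdom F j \<inter> cdom F j'"
      using p by (auto simp: k(1) l(1))
    let ?U = "chart B i ` (cdom B i \<inter> cdom B i')" and ?V = "chart F j ` (cdom F j \<inter> cdom F j')"
    let ?z = "vjoin (chart B i p1) (chart F j p2)"
    have U: "open ?U" and V: "open ?V"
      using open_chart_overlap[OF B k(2) l(2)] open_chart_overlap[OF F k(3) l(3)] by auto
    have z: "?z \<in> coord_prod ?U ?V" using p12 by (auto simp: coord_prod_def)
    define J1 where "J1 = jacobian (loc B i (chart B i')) (at (chart B i p1))"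
    define J2 where "J2 = jacobian (loc F j (chart F j')) (at (chart F j p2))"
    have "smooth_on ?U (loc B i (chart B i'))" "smooth_on ?V (loc F j (chart F j'))"
      using B F k l unfolding smooth_manifold_def by blast+
    then have "loc B i (chart B i') differentiable at (vleft ?z)"
      "loc F j (chart F j') differentiable at (vright ?z)"
      using p12 by (auto intro: smooth_on_differentiable)
    moreover have "loc ?P (i, j) (chart ?P (i', j')) w
        = vjoin (loc B i (chart B i') (vleft w)) (loc F j (chart F j') (vright w))"
      if "w \<in> coord_prod ?U ?V" for w
    proof -
      have "w \<in> coord_prod (cimage B i) (cimage F j)"
        using that by (auto simp: coord_prod_def cimage_def)
      then show ?thesis by (rule transition_product[OF cB(1)[OF k(2)] cF(1)[OF k(3)]])
    qed
    ultimately have J: "jacobian (loc ?P k (chart ?P l)) (at ?z) = block_diag J1 J2"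
      unfolding k(1) l(1)
      using jacobian_product[OF open_coord_prod[OF U V] z, of "loc ?P (i, j) (chart ?P (i', j'))"
          "loc B i (chart B i')" "loc F j (chart F j')"]
      by (simp add: J1_def J2_def del: product_manifold_simps(4))
    have "gB i (chart B i p1) = transpose J1 ** gB i' (chart B i' p1) ** J1"
      "gF j (chart F j p2) = transpose J2 ** gF j' (chart F j' p2) ** J2"
      unfolding J1_def J2_def
      by (rule metric_transformation[OF gB k(2) l(2) p12(2)] metric_transformation[OF gF k(3) l(3) p12(3)])+
    moreover have "loc B i f (chart B i p1) = f p1" "loc B i' f (chart B i' p1) = f p1"
      using p12 loc_chart[OF cB(1)[OF k(2)]] loc_chart[OF cB(1)[OF l(2)]] by auto
    ultimately show "let J = jacobian (loc ?P k (chart ?P l)) (at (chart ?P k p))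
        in warped_metric B gB f gF k (chart ?P k p)
          = transpose J ** warped_metric B gB f gF l (chart ?P l p) ** J"
      using J
      by (simp add: Let_def k(1) l(1) p12(1) warped_metric_eq warped_coords_def
          transpose_block_diag block_diag_mult scaleR_matrix_mult)
  qed
qed

section \<open>Smoothness of the inverse metric and of the Christoffel symbols\<close>

lemma smooth_on_det:
  fixes G :: "real^'n::finite \<Rightarrow> real^'k::finite^'k"
  assumes "open S" "\<And>i j. smooth_on S (\<lambda>x. G x $ i $ j)"
  shows "smooth_on S (\<lambda>x. det (G x))"
  unfolding det_def by (intro smooth_on_sum smooth_on_cmult smooth_on_prod assms) auto

text \<open>Cramer's rule writes the entries of the inverse as quotients of determinants, hence of
  polynomials in the entries of the matrix. This is what makes the inverse metric smooth.\<close>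

lemma matrix_inv_cramer:
  fixes A :: "real^'k::finite^'k"
  assumes "invertible A"
  shows "matrix_inv A $ i $ j = det (\<chi> k l. if l = i then axis j 1 $ k else A $ k $ l) / det A"
proof -
  have "A *v column j (matrix_inv A) = axis j 1"
  proof -
    have "A *v (matrix_inv A *v axis j 1) = axis j 1"
      by (simp add: matrix_vector_mul_assoc matrix_inv_mult[OF assms])
    then show ?thesis by (simp add: matrix_vector_mult_basis)
  qed
  then have "column j (matrix_inv A) = (\<chi> i. det (\<chi> k l. if l = i then axis j 1 $ k else A $ k $ l) / det A)"
    using cramer[of A "column j (matrix_inv A)" "axis j 1"] assms by (simp add: invertible_det_nz)
  then show ?thesis by (simp add: column_def vec_eq_iff)
qed

lemma smooth_on_matrix_inv:
  fixes G :: "real^'n::finite \<Rightarrow> real^'k::finite^'k"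
  assumes "open S" "smooth_on S G" "\<And>x. x \<in> S \<Longrightarrow> invertible (G x)"
  shows "smooth_on S (\<lambda>x. matrix_inv (G x) $ i $ j)"
proof -
  have G: "smooth_on S (\<lambda>x. G x $ k $ l)" for k l
    using assms(2) by (simp add: smooth_on_vec_iff[OF assms(1)])
  have "smooth_on S (\<lambda>x. if l = i then axis j 1 $ k else G x $ k $ l)" for k l
    using G by (cases "l = i") auto
  then have "smooth_on S (\<lambda>x. det (\<chi> k l. if l = i then axis j 1 $ k else G x $ k $ l))"
    by (intro smooth_on_det assms(1)) simp
  moreover have "smooth_on S (\<lambda>x. inverse (det (G x)))"
    using assms(3) by (intro smooth_on_inverse smooth_on_det assms(1) G) (simp add: invertible_det_nz)
  ultimately have "smooth_on S (\<lambda>x. det (\<chi> k l. if l = i then axis j 1 $ k else G x $ k $ l) * inverse (det (G x)))"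
    by (rule smooth_on_mult[OF assms(1)])
  then show ?thesis
    by (rule smooth_on_cong[OF assms(1), THEN iffD2, rotated])
      (simp add: matrix_inv_cramer[OF assms(3)] divide_inverse)
qed

text \<open>Needed because the partial derivatives of the Christoffel symbols of the two factors,
  viewed as functions on the product, are computed by the chain rule, which requires differentiability.\<close>

lemma smooth_on_christoffel:
  assumes "open S" "smooth_on S G" "\<And>x. x \<in> S \<Longrightarrow> invertible (G x)"
  shows "smooth_on S (christoffel G k i j)"
proof -
  have G: "smooth_on S (\<lambda>x. G x $ k $ l)" for k l
    using assms(2) by (simp add: smooth_on_vec_iff[OF assms(1)])
  have "smooth_on S (\<lambda>x. (1/2) * (\<Sum>l\<in>UNIV. matrix_inv (G x) $ k $ l *
        (pd i (\<lambda>y. G y $ j $ l) x + pd j (\<lambda>y. G y $ i $ l) x - pd l (\<lambda>y. G y $ i $ j) x)))"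
    by (intro smooth_on_cmult smooth_on_sum smooth_on_mult smooth_on_diff smooth_on_add
        smooth_on_matrix_inv smooth_on_pd G assms)
  then show ?thesis by (simp add: christoffel_def[abs_def])
qed

section \<open>Curvature of a warped product in coordinates\<close>

definition gradient :: "(real^'n \<Rightarrow> real^'n^'n) \<Rightarrow> (real^'n \<Rightarrow> real) \<Rightarrow> real^'n::finite \<Rightarrow> real^'n" where
  "gradient G u x = (\<chi> c. \<Sum>d\<in>UNIV. matrix_inv (G x) $ c $ d * pd d u x)"

text \<open>The factor \<open>\<Sum>\<^sub>d \<Gamma>\<^sup>d\<^sub>d\<^sub>c\<close> is the logarithmic derivative of the
  volume density. The divergence of the gradient and the trace of the Hessian are both the
  Laplacian; they are kept apart because they arise from different components of the Ricci tensor.\<close>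

definition divergence :: "(real^'n \<Rightarrow> real^'n^'n) \<Rightarrow> (real^'n \<Rightarrow> real^'n) \<Rightarrow> real^'n::finite \<Rightarrow> real" where
  "divergence G X x = (\<Sum>c\<in>UNIV. pd c (\<lambda>y. X y $ c) x + (\<Sum>d\<in>UNIV. christoffel G d d c x) * X x $ c)"

definition metric_trace :: "(real^'n \<Rightarrow> real^'n^'n) \<Rightarrow> (real^'n \<Rightarrow> real^'n^'n) \<Rightarrow> real^'n::finite \<Rightarrow> real" where
  "metric_trace G T x = (\<Sum>a\<in>UNIV. \<Sum>b\<in>UNIV. matrix_inv (G x) $ a $ b * T x $ a $ b)"

text \<open>For \<open>X\<close> the gradient of \<open>u\<close> and \<open>v\<close> a function this is the
  inner product \<open>\<langle>\<nabla>u, \<nabla>v\<rangle>\<close>.\<close>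

definition derivation :: "(real^'n \<Rightarrow> real^'n) \<Rightarrow> (real^'n \<Rightarrow> real) \<Rightarrow> real^'n::finite \<Rightarrow> real" where
  "derivation X u x = (\<Sum>c\<in>UNIV. X x $ c * pd c u x)"

text \<open>One chart of a warped product: \<open>G\<close> and \<open>H\<close> are the coordinate matrices of the
  metrics of base and fibre.\<close>

locale warped_chart =
  fixes G :: "real^'n::finite \<Rightarrow> real^'n^'n" and f :: "real^'n \<Rightarrow> real"
    and H :: "real^'m::finite \<Rightarrow> real^'m^'m" and U :: "(real^'n) set" and V :: "(real^'m) set"
  assumes open_U: "open U" and open_V: "open V"
    and G_smooth: "smooth_on U G" and f_smooth: "smooth_on U f" and H_smooth: "smooth_on V H"
    and G_inv: "x \<in> U \<Longrightarrow> invertible (G x)"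
    and H_sym: "y \<in> V \<Longrightarrow> transpose (H y) = H y" and H_inv: "y \<in> V \<Longrightarrow> invertible (H y)"
    and f_nz: "x \<in> U \<Longrightarrow> f x \<noteq> 0"
begin

abbreviation "D \<equiv> coord_prod U V"
abbreviation "W \<equiv> warped_coords G f H"

lemma open_D: "open D" by (rule open_coord_prod[OF open_U open_V])

lemma D_iff: "z \<in> D \<longleftrightarrow> vleft z \<in> U \<and> vright z \<in> V" by (simp add: coord_prod_def)

lemma G_entry_smooth: "smooth_on U (\<lambda>x. G x $ a $ b)"
  using G_smooth by (simp add: smooth_on_vec_iff[OF open_U])

lemma H_entry_smooth: "smooth_on V (\<lambda>y. H y $ a $ b)"
  using H_smooth by (simp add: smooth_on_vec_iff[OF open_V])

lemma H_entry_sym: "y \<in> V \<Longrightarrow> H y $ a $ b = H y $ b $ a"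
proof -
  assume "y \<in> V"
  then have "transpose (H y) $ b $ a = H y $ b $ a" by (simp add: H_sym)
  then show ?thesis by (simp add: transpose_def)
qed

lemma diff_vleft: "smooth_on U u \<Longrightarrow> z \<in> D \<Longrightarrow> (\<lambda>z. u (vleft z)) differentiable at z"
  by (rule differentiable_vleft) (simp add: smooth_on_differentiable D_iff)

lemma diff_vright: "smooth_on V u \<Longrightarrow> z \<in> D \<Longrightarrow> (\<lambda>z. u (vright z)) differentiable at z"
  by (rule differentiable_vright) (simp add: smooth_on_differentiable D_iff)

lemma pd_left:
  assumes "smooth_on U u" "z \<in> D"
  shows "pd (Inl a) (\<lambda>z. u (vleft z)) z = pd a u (vleft z)" "pd (Inr b) (\<lambda>z. u (vleft z)) z = 0"
  using assms by (auto intro!: pd_vleft smooth_on_differentiable simp: D_iff)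

lemma pd_right:
  assumes "smooth_on V u" "z \<in> D"
  shows "pd (Inl a) (\<lambda>z. u (vright z)) z = 0" "pd (Inr b) (\<lambda>z. u (vright z)) z = pd b u (vright z)"
  using assms by (auto intro!: pd_vright smooth_on_differentiable simp: D_iff)

lemma pd_left_right:
  fixes u :: "real^'n \<Rightarrow> real" and v :: "real^'m \<Rightarrow> real"
  assumes "smooth_on U u" "smooth_on V v" "z \<in> D"
  shows "pd (Inl a) (\<lambda>z. u (vleft z) * v (vright z)) z = pd a u (vleft z) * v (vright z)"
    "pd (Inr b) (\<lambda>z. u (vleft z) * v (vright z)) z = u (vleft z) * pd b v (vright z)"
  by (simp_all add: pd_mult[OF diff_vleft[OF assms(1,3)] diff_vright[OF assms(2,3)]]
      pd_left[OF assms(1,3)] pd_right[OF assms(2,3)])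

lemma f2_smooth: "smooth_on U (\<lambda>x. (f x)\<^sup>2)"
  unfolding power2_eq_square by (rule smooth_on_mult[OF open_U f_smooth f_smooth])

lemma pd_f2: "x \<in> U \<Longrightarrow> pd a (\<lambda>x. (f x)\<^sup>2) x = 2 * f x * pd a f x"
  unfolding power2_eq_square
  by (simp add: pd_mult smooth_on_differentiable[OF f_smooth])

lemma W_nth:
  "(\<lambda>z. W z $ Inl a $ Inl b) = (\<lambda>z. G (vleft z) $ a $ b)"
  "(\<lambda>z. W z $ Inl a $ Inr d) = (\<lambda>z. 0)"
  "(\<lambda>z. W z $ Inr c $ Inl b) = (\<lambda>z. 0)"
  "(\<lambda>z. W z $ Inr c $ Inr d) = (\<lambda>z. (f (vleft z))\<^sup>2 * H (vright z) $ c $ d)"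
  by (simp_all add: warped_coords_def)

lemma pd_W:
  assumes "z \<in> D"
  shows "pd (Inl e) (\<lambda>z. W z $ Inl a $ Inl b) z = pd e (\<lambda>x. G x $ a $ b) (vleft z)"
    "pd (Inr e') (\<lambda>z. W z $ Inl a $ Inl b) z = 0"
    "pd k (\<lambda>z. W z $ Inl a $ Inr d) z = 0"
    "pd k (\<lambda>z. W z $ Inr c $ Inl b) z = 0"
    "pd (Inl e) (\<lambda>z. W z $ Inr c $ Inr d) z = 2 * f (vleft z) * pd e f (vleft z) * H (vright z) $ c $ d"
    "pd (Inr e') (\<lambda>z. W z $ Inr c $ Inr d) z = (f (vleft z))\<^sup>2 * pd e' (\<lambda>y. H y $ c $ d) (vright z)"
  using assms unfolding W_nth
  by (simp_all add: pd_left[OF G_entry_smooth] pd_left_right[OF f2_smooth H_entry_smooth] pd_f2 D_iff)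

lemma matrix_inv_W:
  assumes "z \<in> D"
  shows "matrix_inv (W z)
    = block_diag (matrix_inv (G (vleft z))) (inverse ((f (vleft z))\<^sup>2) *\<^sub>R matrix_inv (H (vright z)))"
  using assms unfolding warped_coords_def D_iff
  by (simp add: matrix_inv_block_diag matrix_inv_scaleR G_inv H_inv f_nz)

lemma sum_inverse_H:
  assumes "y \<in> V"
  shows "(\<Sum>d\<in>UNIV. matrix_inv (H y) $ c $ d * H y $ b $ d) = (if c = b then 1 else 0)"
proof -
  have "(matrix_inv (H y) ** H y) $ c $ b = (if c = b then 1 else 0)"
    by (simp add: matrix_inv_mult[OF H_inv[OF assms]] mat_def)
  then show ?thesis
    by (simp add: matrix_matrix_mult_def H_entry_sym[OF assms, of b])
qed

text \<open>Latin indices \<open>a, b, c\<close> belong to the base and primed ones to the fibre. The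
  mixed symbols come from \<open>\<partial>\<^sub>a (f\<^sup>2 H) = 2 f (\<partial>\<^sub>a f) H\<close>: contracting with the
  inverse of \<open>f\<^sup>2 H\<close> cancels \<open>H\<close> and leaves a Kronecker delta, contracting with the
  inverse of \<open>G\<close> raises the index of the gradient.\<close>

lemma christoffel_W:
  assumes z: "z \<in> D"
  shows "christoffel W (Inl c) (Inl a) (Inl b) z = christoffel G c a b (vleft z)"
    "christoffel W (Inr c') (Inl a) (Inl b) z = 0"
    "christoffel W (Inl c) (Inl a) (Inr b') z = 0"
    "christoffel W (Inl c) (Inr a') (Inl b) z = 0"
    "christoffel W (Inr c') (Inl a) (Inr b') z = (if c' = b' then pd a f (vleft z) / f (vleft z) else 0)"
    "christoffel W (Inr c') (Inr a') (Inl b) z = (if c' = a' then pd b f (vleft z) / f (vleft z) else 0)"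
    "christoffel W (Inl c) (Inr a') (Inr b') z
      = - (f (vleft z) * gradient G f (vleft z) $ c) * H (vright z) $ a' $ b'"
    "christoffel W (Inr c') (Inr a') (Inr b') z = christoffel H c' a' b' (vright z)"
proof -
  let ?x = "vleft z" and ?y = "vright z"
  have nz: "f ?x \<noteq> 0" and y: "?y \<in> V" using z f_nz by (auto simp: D_iff)
  note c = christoffel_def sum_UNIV_sum matrix_inv_W[OF z] pd_W[OF z]
  show "christoffel W (Inl c) (Inl a) (Inl b) z = christoffel G c a b (vleft z)"
    "christoffel W (Inr c') (Inl a) (Inl b) z = 0"
    "christoffel W (Inl c) (Inl a) (Inr b') z = 0"
    "christoffel W (Inl c) (Inr a') (Inl b) z = 0"
    by (simp_all add: c)
  have *: "(\<Sum>d\<in>UNIV. inverse ((f ?x)\<^sup>2) * matrix_inv (H ?y) $ c' $ d * (2 * f ?x * u * H ?y $ b' $ d))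
      = (if c' = b' then 2 * (u / f ?x) else 0)" for u b'
  proof -
    have "(\<Sum>d\<in>UNIV. inverse ((f ?x)\<^sup>2) * matrix_inv (H ?y) $ c' $ d * (2 * f ?x * u * H ?y $ b' $ d))
      = 2 * (u / f ?x) * (\<Sum>d\<in>UNIV. matrix_inv (H ?y) $ c' $ d * H ?y $ b' $ d)"
      unfolding sum_distrib_left
      using nz by (intro sum.cong) (auto simp: field_simps power2_eq_square)
    then show ?thesis by (simp add: sum_inverse_H[OF y])
  qed
  show "christoffel W (Inr c') (Inl a) (Inr b') z = (if c' = b' then pd a f (vleft z) / f (vleft z) else 0)"
    "christoffel W (Inr c') (Inr a') (Inl b) z = (if c' = a' then pd b f (vleft z) / f (vleft z) else 0)"
    using *[of _ b'] *[of _ a'] by (simp_all add: c)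
  show "christoffel W (Inl c) (Inr a') (Inr b') z
      = - (f (vleft z) * gradient G f (vleft z) $ c) * H (vright z) $ a' $ b'"
    by (simp add: c gradient_def sum_distrib_left sum_distrib_right sum_negf mult_ac)
  show "christoffel W (Inr c') (Inr a') (Inr b') z = christoffel H c' a' b' (vright z)"
    using nz
    by (simp add: c flip: right_diff_distrib distrib_left) (intro sum.cong; simp)
qed

lemma gradient_smooth: "smooth_on U (\<lambda>x. gradient G f x $ c)"
  unfolding gradient_def
  by (simp, intro smooth_on_sum smooth_on_mult smooth_on_matrix_inv smooth_on_pd open_U G_smooth f_smooth G_inv)

lemma f_gradient_smooth: "smooth_on U (\<lambda>x. - (f x * gradient G f x $ c))"
  using smooth_on_cmult[OF open_U smooth_on_mult[OF open_U f_smooth gradient_smooth[of c]], of "- 1"] by simp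

lemma dlog_f_smooth: "smooth_on U (\<lambda>x. pd a f x / f x)"
  unfolding divide_inverse
  by (intro smooth_on_mult smooth_on_inverse smooth_on_pd open_U f_smooth f_nz)

lemma pd_dlog_f:
  assumes "x \<in> U"
  shows "pd b (\<lambda>x. pd a f x / f x) x = pd b (pd a f) x / f x - pd a f x * pd b f x / (f x)\<^sup>2"
  unfolding divide_inverse
  using assms f_nz[OF assms]
  by (simp add: pd_mult pd_inverse smooth_on_differentiable[OF f_smooth]
      smooth_on_differentiable[OF smooth_on_pd[OF f_smooth]] power2_eq_square)

lemma pd_f_gradient:
  assumes "x \<in> U"
  shows "pd b (\<lambda>x. - (f x * gradient G f x $ c)) x
    = - (pd b f x * gradient G f x $ c + f x * pd b (\<lambda>x. gradient G f x $ c) x)"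
  using assms
  by (simp add: pd_minus pd_mult smooth_on_differentiable[OF f_smooth] smooth_on_differentiable[OF gradient_smooth])

lemma pd_christoffel_W:
  assumes z: "z \<in> D"
  shows "pd (Inl e) (christoffel W (Inl c) (Inl a) (Inl b)) z = pd e (christoffel G c a b) (vleft z)"
    "pd k (christoffel W (Inr c') (Inl a) (Inl b)) z = 0"
    "pd k (christoffel W (Inl c) (Inl a) (Inr b')) z = 0"
    "pd k (christoffel W (Inl c) (Inr a') (Inl b)) z = 0"
    "pd (Inl e) (christoffel W (Inr c') (Inr a') (Inl b)) z
      = (if c' = a' then pd e (\<lambda>x. pd b f x / f x) (vleft z) else 0)"
    "pd (Inl e) (christoffel W (Inl c) (Inr a') (Inr b')) z
      = - (pd e f (vleft z) * gradient G f (vleft z) $ c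
          + f (vleft z) * pd e (\<lambda>x. gradient G f x $ c) (vleft z)) * H (vright z) $ a' $ b'"
    "pd (Inr e') (christoffel W (Inr c') (Inr a') (Inr b')) z = pd e' (christoffel H c' a' b') (vright z)"
proof -
  have cong: "pd k (christoffel W l i j) z = pd k v z"
    if "\<And>w. w \<in> D \<Longrightarrow> christoffel W l i j w = v w" for k l i j v
    by (rule pd_cong_open[OF open_D z that])
  have CG: "smooth_on U (christoffel G c a b)" for a b c
    by (rule smooth_on_christoffel[OF open_U G_smooth G_inv])
  have CH: "smooth_on V (christoffel H c a b)" for a b c
    by (rule smooth_on_christoffel[OF open_V H_smooth H_inv])
  show "pd (Inl e) (christoffel W (Inl c) (Inl a) (Inl b)) z = pd e (christoffel G c a b) (vleft z)"
    by (subst cong[OF christoffel_W(1)]) (simp_all add: pd_left[OF CG z])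
  show "pd k (christoffel W (Inr c') (Inl a) (Inl b)) z = 0"
    by (subst cong[OF christoffel_W(2)]) simp_all
  show "pd k (christoffel W (Inl c) (Inl a) (Inr b')) z = 0"
    by (subst cong[OF christoffel_W(3)]) simp_all
  show "pd k (christoffel W (Inl c) (Inr a') (Inl b)) z = 0"
    by (subst cong[OF christoffel_W(4)]) simp_all
  show "pd (Inl e) (christoffel W (Inr c') (Inr a') (Inl b)) z
      = (if c' = a' then pd e (\<lambda>x. pd b f x / f x) (vleft z) else 0)"
    by (subst cong[OF christoffel_W(6)]) (simp_all add: pd_left(1)[OF dlog_f_smooth z])
  show "pd (Inl e) (christoffel W (Inl c) (Inr a') (Inr b')) z
      = - (pd e f (vleft z) * gradient G f (vleft z) $ c
          + f (vleft z) * pd e (\<lambda>x. gradient G f x $ c) (vleft z)) * H (vright z) $ a' $ b'"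
    using z
    by (subst cong[OF christoffel_W(7)])
      (simp_all only: pd_left_right[OF f_gradient_smooth H_entry_smooth] pd_f_gradient D_iff)
  show "pd (Inr e') (christoffel W (Inr c') (Inr a') (Inr b')) z = pd e' (christoffel H c' a' b') (vright z)"
    by (subst cong[OF christoffel_W(8)]) (simp_all add: pd_right[OF CH z])
qed

text \<open>Each of the \<open>m\<close> fibre directions contributes
  \<open>- Hess f / f\<close>: the term \<open>\<partial>\<^sub>a f \<partial>\<^sub>b f / f\<^sup>2\<close> in the derivative of
  \<open>\<partial>\<^sub>b f / f\<close> cancels against the product of two mixed symbols.\<close>

lemma ricci_W_base:
  assumes z: "z \<in> D"
  shows "ricci W (Inl a) (Inl b) z = ricci G a b (vleft z)
    - real CARD('m) / f (vleft z) * hessian G f (vleft z) $ a $ b"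
proof -
  have x: "vleft z \<in> U" using z by (simp add: D_iff)
  show ?thesis
    using f_nz[OF x]
    by (simp add: ricci_def riemann_def sum_UNIV_sum christoffel_W[OF z] pd_christoffel_W[OF z]
        pd_dlog_f[OF x] hessian_def if_distrib if_distribR sum.distrib sum_subtractf cong: if_cong)
      (simp add: field_simps power2_eq_square sum_distrib_left)
qed

text \<open>Differentiating \<open>- f (\<nabla>f)\<^sup>c H\<close> and adding its contraction with
  \<open>\<Gamma>\<^sup>d\<^sub>d\<^sub>c\<close> gives \<open>- (|\<nabla>f|\<^sup>2 + f div \<nabla>f) H\<close>. The products of mixed symbols
  contribute \<open>- |\<nabla>f|\<^sup>2 H\<close> with factor \<open>m\<close> from the traced symbol
  \<open>\<Gamma>\<^sup>\<gamma>\<^sub>\<gamma>\<^sub>c = m \<partial>\<^sub>c f / f\<close> and factor \<open>- 2\<close> from the quadratic term, which makes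
  \<open>m - 1\<close> in total.\<close>

lemma ricci_W_fibre:
  assumes z: "z \<in> D"
  shows "ricci W (Inr a) (Inr b) z = ricci H a b (vright z)
    - (f (vleft z) * divergence G (gradient G f) (vleft z)
       + (real CARD('m) - 1) * derivation (gradient G f) f (vleft z)) * H (vright z) $ a $ b"
proof -
  have x: "vleft z \<in> U" using z by (simp add: D_iff)
  (* The Kronecker deltas of the mixed symbols leave double sums over fibre and base indices;
     exchanging the order of summation collapses them. *)
  have single: "(\<Sum>c\<in>UNIV. \<Sum>d\<in>UNIV. if c = a then g d else 0) = (\<Sum>d\<in>UNIV. g d)"
    for g :: "'n \<Rightarrow> real"
    by (subst sum.swap) simp
  have swap: "(\<Sum>c\<in>UNIV. \<Sum>d\<in>UNIV. christoffel G c c d (vleft z) * g d)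
      = (\<Sum>d\<in>UNIV. (\<Sum>c\<in>UNIV. christoffel G c c d (vleft z)) * g d)" for g :: "'n \<Rightarrow> real"
    by (subst sum.swap) (simp add: sum_distrib_right)
  show ?thesis
    using f_nz[OF x]
    by (simp add: ricci_def riemann_def sum_UNIV_sum christoffel_W[OF z] pd_christoffel_W[OF z]
        divergence_def derivation_def if_distrib if_distribR sum.distrib sum_subtractf cong: if_cong)
      (simp add: single swap sum_negf, simp add: sum_negf sum_subtractf sum.distrib sum_distrib_left sum_distrib_right algebra_simps)
qed

text \<open>Only the two diagonal blocks of the Ricci tensor enter, because the inverse metric is
  block diagonal; tracing \<open>H\<close> against its own inverse gives the factor \<open>m\<close>.\<close>

lemma scalar_curvature_W:
  assumes z: "z \<in> D"
  defines "x \<equiv> vleft z" and "m \<equiv> real CARD('m)"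
  shows "scalar_curvature W z = scalar_curvature G x + scalar_curvature H (vright z) / (f x)\<^sup>2
    - m / f x * (metric_trace G (hessian G f) x + divergence G (gradient G f) x)
    - m * (m - 1) / (f x)\<^sup>2 * derivation (gradient G f) f x"
proof -
  have x: "x \<in> U" and y: "vright z \<in> V" using z by (simp_all add: x_def D_iff)
  have tr: "(\<Sum>a\<in>UNIV. \<Sum>b\<in>UNIV. matrix_inv (H (vright z)) $ a $ b * H (vright z) $ a $ b) = m"
    by (simp add: sum_inverse_H[OF y] m_def)
  let ?c = "f x * divergence G (gradient G f) x + (m - 1) * derivation (gradient G f) f x"
  have "(\<Sum>a\<in>UNIV. \<Sum>b\<in>UNIV. matrix_inv (G x) $ a $ b * ricci W (Inl a) (Inl b) z)
      = scalar_curvature G x - m / f x * metric_trace G (hessian G f) x"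
    by (simp add: ricci_W_base[OF z] scalar_curvature_def metric_trace_def right_diff_distrib sum_subtractf
        sum_distrib_left mult_ac flip: x_def m_def)
  moreover have "(\<Sum>a\<in>UNIV. \<Sum>b\<in>UNIV. matrix_inv (H (vright z)) $ a $ b * ricci W (Inr a) (Inr b) z)
      = scalar_curvature H (vright z)
        - ?c * (\<Sum>a\<in>UNIV. \<Sum>b\<in>UNIV. matrix_inv (H (vright z)) $ a $ b * H (vright z) $ a $ b)"
    unfolding ricci_W_fibre[OF z] scalar_curvature_def x_def[symmetric] m_def[symmetric]
    unfolding right_diff_distrib sum_subtractf sum_distrib_left
    by (simp add: mult_ac)
  moreover have "scalar_curvature W z
      = (\<Sum>a\<in>UNIV. \<Sum>b\<in>UNIV. matrix_inv (G x) $ a $ b * ricci W (Inl a) (Inl b) z)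
        + (\<Sum>a\<in>UNIV. \<Sum>b\<in>UNIV. matrix_inv (H (vright z)) $ a $ b * ricci W (Inr a) (Inr b) z) / (f x)\<^sup>2"
    by (simp add: scalar_curvature_def sum_UNIV_sum matrix_inv_W[OF z] sum_divide_distrib divide_inverse
        sum_distrib_left mult_ac flip: x_def)
  ultimately have S: "scalar_curvature W z = scalar_curvature G x - m / f x * metric_trace G (hessian G f) x
      + (scalar_curvature H (vright z) - ?c * m) / (f x)\<^sup>2"
    by (simp only: tr)
  show ?thesis
    unfolding S using f_nz[OF x] by (simp add: field_simps power2_eq_square)
qed

text \<open>A function of \<open>x\<close> has no second derivatives in fibre directions, so its fibre
  block comes entirely from \<open>\<Gamma>\<^sup>c\<^sub>\<alpha>\<^sub>\<beta>\<close>.\<close>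

lemma hessian_W:
  assumes z: "z \<in> D" and h: "smooth_on U h"
  shows "hessian W (\<lambda>z. h (vleft z)) z = block_diag (hessian G h (vleft z))
    ((f (vleft z) * derivation (gradient G f) h (vleft z)) *\<^sub>R H (vright z))"
proof -
  have 1: "pd (Inl a) (\<lambda>z. h (vleft z)) w = pd a h (vleft w)" "pd (Inr b) (\<lambda>z. h (vleft z)) w = 0"
    if "w \<in> D" for a b w
    using pd_left[OF h that] by auto
  have 2: "pd k (pd (Inl a) (\<lambda>z. h (vleft z))) z = pd k (\<lambda>z. pd a h (vleft z)) z" for a k
    by (rule pd_cong_open[OF open_D z 1(1)])
  have 4: "pd k (pd (Inr b) (\<lambda>z. h (vleft z))) z = 0" for b k
    by (subst pd_cong_open[OF open_D z 1(2)]) simp_all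
  have 3: "pd (Inl c) (\<lambda>z. pd a h (vleft z)) z = pd c (pd a h) (vleft z)"
    "pd (Inr d) (\<lambda>z. pd a h (vleft z)) z = 0" for a c d
    using pd_left[OF smooth_on_pd[OF h] z] by auto
  show ?thesis
    by (rule block_diag_eqI)
      (simp_all add: hessian_def sum_UNIV_sum christoffel_W[OF z] 1[OF z] 2 3 4 derivation_def
        if_distrib if_distribR sum_distrib_left sum_distrib_right sum_negf mult_ac cong: if_cong)
qed

end

section \<open>Conformally flat metrics\<close>

text \<open>The metric \<open>\<phi>\<^sup>-\<^sup>2 g\<close> with \<open>g\<close> pseudo-Euclidean. The curvature is computed in
  the logarithmic derivatives of \<open>\<phi>\<close>, in which the Christoffel symbols are linear
  with constant coefficients.\<close>

locale conformally_flat =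
  fixes \<epsilon> :: "'n::finite \<Rightarrow> real" and \<phi> :: "real^'n \<Rightarrow> real" and n :: real
  assumes n_def: "n = real CARD('n)" and eps: "\<epsilon> i \<in> {-1, 1}"
    and phi_smooth: "smooth_on UNIV \<phi>" and phi_nz: "\<phi> x \<noteq> 0"
begin

abbreviation "\<eta> \<equiv> \<chi> i j. if i = j then \<epsilon> i else 0"
definition gbar :: "real^'n \<Rightarrow> real^'n^'n" where "gbar x = (1 / (\<phi> x)\<^sup>2) *\<^sub>R \<eta>"
definition dlog :: "'n \<Rightarrow> real^'n \<Rightarrow> real" where "dlog k x = pd k \<phi> x / \<phi> x"
abbreviation "ip X Y \<equiv> \<Sum>k\<in>UNIV. \<epsilon> k * X k * Y k"

lemma card_n [simp]: "real CARD('n) = n" by (simp add: n_def)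

lemma eps_sq [simp]: "\<epsilon> k * \<epsilon> k = 1" "\<epsilon> k * (\<epsilon> k * u) = u"
  using eps[of k] by auto

lemma matrix_inv_gbar: "matrix_inv (gbar x) = (\<phi> x)\<^sup>2 *\<^sub>R \<eta>"
proof (rule matrix_inv_eqI)
  show "gbar x ** ((\<phi> x)\<^sup>2 *\<^sub>R \<eta>) = mat 1"
    using phi_nz[of x] by (simp add: gbar_def scaleR_matrix_mult sign_matrix_square[OF eps])
qed

lemma phi_differentiable: "\<phi> differentiable at x" "pd k \<phi> differentiable at x"
  by (simp_all add: smooth_on_differentiable[OF phi_smooth] smooth_on_differentiable[OF smooth_on_pd[OF phi_smooth]])

lemma dlog_smooth: "smooth_on UNIV (dlog k)"
  unfolding dlog_def[abs_def] divide_inverse by (intro smooth_on_mult smooth_on_inverse smooth_on_pd phi_smooth phi_nz open_UNIV)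

lemma dlog_differentiable: "dlog k differentiable at x"
  by (simp add: smooth_on_differentiable[OF dlog_smooth])

lemma pd_dlog: "pd j (dlog k) x = pd j (pd k \<phi>) x / \<phi> x - dlog j x * dlog k x"
  unfolding dlog_def[abs_def] divide_inverse
  using phi_nz[of x]
  by (simp add: pd_mult pd_inverse differentiable_inverse phi_differentiable)

lemma pd_gbar: "pd c (\<lambda>x. gbar x $ a $ b) x = (if a = b then \<epsilon> a * (- 2 * dlog c x / (\<phi> x)\<^sup>2) else 0)"
proof -
  have 1: "pd c (\<lambda>x. inverse (\<phi> x) * inverse (\<phi> x)) x = - 2 * dlog c x / (\<phi> x)\<^sup>2"
    using phi_nz[of x]
    by (simp add: pd_mult pd_inverse differentiable_inverse phi_differentiable) (simp add: dlog_def field_simps power2_eq_square)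
  have 2: "(\<lambda>x. inverse (\<phi> x) * inverse (\<phi> x)) differentiable at x"
    using phi_nz[of x] by (intro differentiable_mult differentiable_inverse phi_differentiable)
  have "(\<lambda>x. gbar x $ a $ b) = (\<lambda>x. (if a = b then \<epsilon> a else 0) * (inverse (\<phi> x) * inverse (\<phi> x)))"
    by (simp add: gbar_def fun_eq_iff divide_inverse power2_eq_square)
  then show ?thesis
    by (simp add: pd_cmult[OF 2] 1)
qed

lemma christoffel_gbar: "christoffel gbar k i j = (\<lambda>x. (if i = j then \<epsilon> i * \<epsilon> k else 0) * dlog k x
    - (if k = i then 1 else 0) * dlog j x - (if k = j then 1 else 0) * dlog i x)"
proof
  fix x
  have 1: "(\<Sum>l\<in>UNIV. matrix_inv (gbar x) $ k $ l * X l) = \<epsilon> k * (\<phi> x)\<^sup>2 * X k" for X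
  proof -
    have "matrix_inv (gbar x) $ k $ l * X l = (if l = k then \<epsilon> k * (\<phi> x)\<^sup>2 * X k else 0)" for l
      by (auto simp: matrix_inv_gbar)
    then show ?thesis by simp
  qed
  have 2: "\<epsilon> k * (\<phi> x)\<^sup>2 * (\<epsilon> l * (- 2 * u / (\<phi> x)\<^sup>2)) = - 2 * (\<epsilon> l * \<epsilon> k * u)" for u l
    using phi_nz[of x] by simp
  have 3: "c * (if P then u else 0) = (if P then c * u else 0)" for c u :: real and P
    by simp
  have "christoffel gbar k i j x = 1/2 * (\<epsilon> k * (\<phi> x)\<^sup>2 *
      ((if j = k then \<epsilon> j * (- 2 * dlog i x / (\<phi> x)\<^sup>2) else 0)
        + (if i = k then \<epsilon> i * (- 2 * dlog j x / (\<phi> x)\<^sup>2) else 0)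
        - (if i = j then \<epsilon> i * (- 2 * dlog k x / (\<phi> x)\<^sup>2) else 0)))"
    by (simp only: christoffel_def 1 pd_gbar)
  also have "\<dots> = 1/2 * ((if j = k then - 2 * (\<epsilon> j * \<epsilon> k * dlog i x) else 0)
      + (if i = k then - 2 * (\<epsilon> i * \<epsilon> k * dlog j x) else 0)
      - (if i = j then - 2 * (\<epsilon> i * \<epsilon> k * dlog k x) else 0))"
    unfolding right_diff_distrib distrib_left by (simp only: 3 2)
  finally show "christoffel gbar k i j x = (if i = j then \<epsilon> i * \<epsilon> k else 0) * dlog k x
      - (if k = i then 1 else 0) * dlog j x - (if k = j then 1 else 0) * dlog i x"
    by (cases "i = j"; cases "k = i"; cases "k = j"; simp)
qed

lemma pd_christoffel_gbar: "pd e (christoffel gbar k i j) x = (if i = j then \<epsilon> i * \<epsilon> k else 0) * pd e (dlog k) x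
    - (if k = i then 1 else 0) * pd e (dlog j) x - (if k = j then 1 else 0) * pd e (dlog i) x"
  unfolding christoffel_gbar
  by (simp only: pd_diff pd_cmult differentiable_diff differentiable_mult differentiable_const dlog_differentiable)

text \<open>Contractions with an arbitrary vector turn the double sums over products of
  Christoffel symbols in the Ricci tensor into single sums.\<close>

lemma christoffel_gbar_contract_upper:
  "(\<Sum>k\<in>UNIV. christoffel gbar k i j x * X k)
    = (if i = j then \<epsilon> i * ip (\<lambda>k. dlog k x) X else 0) - dlog j x * X i - dlog i x * X j"
proof -
  have "christoffel gbar k i j x * X k = (if i = j then \<epsilon> i else 0) * (\<epsilon> k * dlog k x * X k)
      - (if k = i then dlog j x * X i else 0) - (if k = j then dlog i x * X j else 0)" for k
    by (auto simp: christoffel_gbar algebra_simps)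
  then show ?thesis
    by (cases "i = j") (simp_all add: sum_subtractf sum_negf sum_distrib_left)
qed

lemma christoffel_gbar_contract_lower:
  "(\<Sum>q\<in>UNIV. christoffel gbar i a q x * X q)
    = \<epsilon> a * \<epsilon> i * dlog i x * X a - (if i = a then (\<Sum>q\<in>UNIV. dlog q x * X q) else 0) - dlog a x * X i"
proof -
  have "christoffel gbar i a q x * X q = (if q = a then \<epsilon> a * \<epsilon> i * dlog i x * X a else 0)
      - (if i = a then 1 else 0) * (dlog q x * X q) - (if q = i then dlog a x * X i else 0)" for q
    by (auto simp: christoffel_gbar algebra_simps)
  then show ?thesis
    by (cases "i = a") (simp_all add: sum_subtractf sum_negf sum_distrib_left)
qed

lemma christoffel_gbar_trace:
  "christoffel gbar i i a x = - dlog a x" "christoffel gbar i a i x = - dlog a x"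
  by (auto simp: christoffel_gbar)

text \<open>Only the diagonal is computed: the metric is diagonal, so the scalar curvature sees
  nothing else.\<close>

lemma ricci_gbar_diag:
  "ricci gbar a a x = (n - 2) * pd a (dlog a) x + \<epsilon> a * (\<Sum>k\<in>UNIV. \<epsilon> k * pd k (dlog k) x)
    + (n - 2) * (dlog a x)\<^sup>2 - (n - 2) * \<epsilon> a * (\<Sum>k\<in>UNIV. \<epsilon> k * (dlog k x)\<^sup>2)"
proof -
  let ?N = "\<Sum>k\<in>UNIV. \<epsilon> k * (dlog k x)\<^sup>2"
  have N: "ip (\<lambda>k. dlog k x) (\<lambda>k. dlog k x) = ?N" by (simp add: power2_eq_square mult.assoc)
  have A: "(\<Sum>i\<in>UNIV. pd i (christoffel gbar i a a) x)
      = \<epsilon> a * (\<Sum>k\<in>UNIV. \<epsilon> k * pd k (dlog k) x) - 2 * pd a (dlog a) x"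
  proof -
    have "pd i (christoffel gbar i a a) x
        = \<epsilon> a * (\<epsilon> i * pd i (dlog i) x) - (if i = a then 2 * pd a (dlog a) x else 0)" for i
      by (auto simp: pd_christoffel_gbar)
    then show ?thesis by (simp add: sum_subtractf sum_distrib_left)
  qed
  have B: "(\<Sum>i\<in>UNIV. pd a (christoffel gbar i i a) x) = - n * pd a (dlog a) x"
  proof -
    have "pd a (christoffel gbar i i a) x = - pd a (dlog a) x" for i
      by (auto simp: pd_christoffel_gbar)
    then show ?thesis by simp
  qed
  have aa: "(\<Sum>q\<in>UNIV. dlog q x * christoffel gbar q a a x) = \<epsilon> a * ?N - 2 * (dlog a x)\<^sup>2"
  proof -
    have "(\<Sum>q\<in>UNIV. christoffel gbar q a a x * dlog q x) = \<epsilon> a * ?N - 2 * (dlog a x)\<^sup>2"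
      unfolding christoffel_gbar_contract_upper N by (simp add: power2_eq_square)
    then show ?thesis by (simp only: mult.commute)
  qed
  have C: "(\<Sum>i\<in>UNIV. \<Sum>q\<in>UNIV. christoffel gbar i i q x * christoffel gbar q a a x)
      = - n * (\<epsilon> a * ?N - 2 * (dlog a x)\<^sup>2)"
    by (simp add: christoffel_gbar_trace sum_negf aa) (simp add: algebra_simps)
  have "(\<Sum>q\<in>UNIV. christoffel gbar i a q x * christoffel gbar q i a x)
      = (dlog a x)\<^sup>2 - \<epsilon> a * (\<epsilon> i * (dlog i x)\<^sup>2) - (if i = a then \<epsilon> a * ?N - 2 * (dlog a x)\<^sup>2 else 0)" for i
    unfolding christoffel_gbar_contract_lower
    by (auto simp: aa christoffel_gbar_trace power2_eq_square)
  then have E: "(\<Sum>i\<in>UNIV. \<Sum>q\<in>UNIV. christoffel gbar i a q x * christoffel gbar q i a x)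
      = n * (dlog a x)\<^sup>2 - \<epsilon> a * ?N - (\<epsilon> a * ?N - 2 * (dlog a x)\<^sup>2)"
    by (simp add: sum_subtractf sum_distrib_left)
  show ?thesis
    unfolding ricci_def riemann_def sum.distrib sum_subtractf A B C E
    by (simp add: algebra_simps)
qed

lemma trace_gbar: "(\<Sum>a\<in>UNIV. \<Sum>b\<in>UNIV. matrix_inv (gbar x) $ a $ b * X a b) = (\<phi> x)\<^sup>2 * (\<Sum>a\<in>UNIV. \<epsilon> a * X a a)"
  by (simp add: matrix_inv_gbar if_distrib if_distribR sum_distrib_left mult_ac cong: if_cong)

lemma scalar_curvature_gbar:
  "scalar_curvature gbar x = (n - 1) * (2 * \<phi> x * (\<Sum>k\<in>UNIV. \<epsilon> k * pd k (pd k \<phi>) x)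
    - n * (\<Sum>k\<in>UNIV. \<epsilon> k * (pd k \<phi> x)\<^sup>2))"
proof -
  let ?L = "\<Sum>k\<in>UNIV. \<epsilon> k * pd k (pd k \<phi>) x" and ?Q = "\<Sum>k\<in>UNIV. \<epsilon> k * (pd k \<phi> x)\<^sup>2"
  define P where "P = (\<Sum>k\<in>UNIV. \<epsilon> k * pd k (dlog k) x)"
  define N where "N = (\<Sum>k\<in>UNIV. \<epsilon> k * (dlog k x)\<^sup>2)"
  have N: "N = ?Q / (\<phi> x)\<^sup>2"
    by (simp add: N_def dlog_def power_divide sum_divide_distrib)
  have P: "P = ?L / \<phi> x - N"
    by (simp add: P_def N_def pd_dlog right_diff_distrib sum_subtractf sum_divide_distrib power2_eq_square)
  have "(\<Sum>a\<in>UNIV. \<epsilon> a * ricci gbar a a x) = (n - 2) * P + n * P + (n - 2) * N - (n - 2) * n * N"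
    unfolding ricci_gbar_diag P_def[symmetric] N_def[symmetric] distrib_left right_diff_distrib
      sum.distrib sum_subtractf
    by (simp add: P_def N_def algebra_simps sum_distrib_left)
  then have "scalar_curvature gbar x = (\<phi> x)\<^sup>2 * ((n - 2) * P + n * P + (n - 2) * N - (n - 2) * n * N)"
    unfolding scalar_curvature_def trace_gbar by simp
  also have "\<dots> = (n - 1) * (2 * \<phi> x * ?L - n * ?Q)"
    using phi_nz[of x] by (simp add: P N field_simps power2_eq_square)
  finally show ?thesis .
qed

lemma hessian_gbar:
  "hessian gbar u x $ i $ j = pd i (pd j u) x + dlog j x * pd i u x + dlog i x * pd j u x
    - (if i = j then \<epsilon> i * ip (\<lambda>k. dlog k x) (\<lambda>k. pd k u x) else 0)"
  using christoffel_gbar_contract_upper[of i j x "\<lambda>k. pd k u x"] by (simp add: hessian_def)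

lemma gradient_gbar: "gradient gbar u x $ c = (\<phi> x)\<^sup>2 * (\<epsilon> c * pd c u x)"
  by (simp add: gradient_def matrix_inv_gbar if_distrib if_distribR mult_ac cong: if_cong)

lemma derivation_gradient_gbar:
  "derivation (gradient gbar u) v x = (\<phi> x)\<^sup>2 * ip (\<lambda>k. pd k u x) (\<lambda>k. pd k v x)"
  by (simp add: derivation_def gradient_gbar sum_distrib_left mult_ac)

lemma metric_trace_hessian_gbar:
  "metric_trace gbar (hessian gbar u) x = (\<phi> x)\<^sup>2 * (\<Sum>k\<in>UNIV. \<epsilon> k * pd k (pd k u) x)
    - (n - 2) * \<phi> x * ip (\<lambda>k. pd k \<phi> x) (\<lambda>k. pd k u x)"
proof -
  have dl: "ip (\<lambda>k. dlog k x) (\<lambda>k. pd k u x) = ip (\<lambda>k. pd k \<phi> x) (\<lambda>k. pd k u x) / \<phi> x"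
    by (simp add: dlog_def sum_divide_distrib)
  have "metric_trace gbar (hessian gbar u) x = (\<phi> x)\<^sup>2 * (\<Sum>k\<in>UNIV. \<epsilon> k * hessian gbar u x $ k $ k)"
    by (simp add: metric_trace_def trace_gbar)
  also have "(\<Sum>k\<in>UNIV. \<epsilon> k * hessian gbar u x $ k $ k)
      = (\<Sum>k\<in>UNIV. \<epsilon> k * pd k (pd k u) x) + (2 - n) * ip (\<lambda>k. dlog k x) (\<lambda>k. pd k u x)"
    by (simp add: hessian_gbar algebra_simps sum.distrib sum_subtractf sum_distrib_left)
  also have "(\<phi> x)\<^sup>2 * (L + (2 - n) * ip (\<lambda>k. dlog k x) (\<lambda>k. pd k u x))
      = (\<phi> x)\<^sup>2 * L - (n - 2) * \<phi> x * ip (\<lambda>k. pd k \<phi> x) (\<lambda>k. pd k u x)" for L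
  proof -
    have "(\<phi> x)\<^sup>2 * ((2 - n) * (I / \<phi> x)) = - ((n - 2) * \<phi> x * I)" for I
      using phi_nz[of x] by (simp add: field_simps power2_eq_square)
    then show ?thesis unfolding dl distrib_left by simp
  qed
  finally show ?thesis .
qed

text \<open>The derivative of \<open>\<phi>\<^sup>2\<close> contributes \<open>2\<close> and the volume density
  \<open>- n\<close> to the coefficient of the first order term, the same sum as for the trace of the Hessian.\<close>

lemma divergence_gradient_gbar:
  assumes "smooth_on UNIV u"
  shows "divergence gbar (gradient gbar u) x = (\<phi> x)\<^sup>2 * (\<Sum>k\<in>UNIV. \<epsilon> k * pd k (pd k u) x)
    - (n - 2) * \<phi> x * ip (\<lambda>k. pd k \<phi> x) (\<lambda>k. pd k u x)"
proof -
  have "pd c (\<lambda>y. gradient gbar u y $ c) x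
      = (\<phi> x)\<^sup>2 * (\<epsilon> c * pd c (pd c u) x) + 2 * \<phi> x * (\<epsilon> c * pd c \<phi> x * pd c u x)" for c
    using smooth_on_differentiable[OF smooth_on_pd[OF assms]] phi_differentiable
    by (simp add: gradient_gbar power2_eq_square pd_mult pd_cmult differentiable_mult algebra_simps)
  moreover have "(\<Sum>d\<in>UNIV. christoffel gbar d d c x) * gradient gbar u x $ c
      = - n * \<phi> x * (\<epsilon> c * pd c \<phi> x * pd c u x)" for c
    using phi_nz[of x] by (simp add: christoffel_gbar_trace gradient_gbar dlog_def power2_eq_square)
  ultimately show ?thesis
    by (simp add: divergence_def sum.distrib sum_subtractf sum_distrib_left algebra_simps)
qed

end

section \<open>The soliton equations\<close>

lemma hessian_cong_open:
  assumes "open S" "z \<in> S" "\<And>w. w \<in> S \<Longrightarrow> u w = v w"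
  shows "hessian G u z = hessian G v z"
proof -
  have "pd k u w = pd k v w" if "w \<in> S" for k w
    by (rule pd_cong_open[OF assms(1) that assms(3)])
  then have "pd i (pd j u) z = pd i (pd j v) z" "pd k u z = pd k v z" for i j k
    using assms by (auto intro: pd_cong_open)
  then show ?thesis by (simp add: hessian_def)
qed

lemma block_diag_eq_iff: "block_diag A B = block_diag A' B' \<longleftrightarrow> A = A' \<and> B = B'"
  by (auto simp: vec_eq_iff all_sum_iff)

lemma scaleR_block_diag: "c *\<^sub>R block_diag A B = block_diag (c *\<^sub>R A) (c *\<^sub>R B)"
  by (rule block_diag_eqI) simp_all

lemma invertible_nonzero:
  fixes A :: "real^'n::finite^'n"
  assumes "invertible A"
  shows "A \<noteq> 0"
proof
  assume "A = 0"
  then have "mat 1 = (0 :: real^'n^'n)"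
    using matrix_inv_mult(1)[OF assms] by simp
  from arg_cong[OF this, of "\<lambda>M. M $ undefined $ undefined"] show False
    by (simp add: mat_def)
qed

text \<open>The scalar curvature of a warped product as a function on its base, for a fibre of
  dimension \<open>m\<close> and constant scalar curvature \<open>lam\<close>.\<close>

definition warped_scalar_curvature ::
    "(real^'n \<Rightarrow> real^'n^'n) \<Rightarrow> (real^'n \<Rightarrow> real) \<Rightarrow> real \<Rightarrow> real \<Rightarrow> real^'n::finite \<Rightarrow> real" where
  "warped_scalar_curvature G u lam m x = scalar_curvature G x + lam / (u x)\<^sup>2
    - m / u x * (metric_trace G (hessian G u) x + divergence G (gradient G u) x)
    - m * (m - 1) / (u x)\<^sup>2 * derivation (gradient G u) u x"

text \<open>In the fibre block one factor \<open>f\<close> cancels, and the matrix \<open>H\<close> can be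
  divided out because an invertible matrix is not zero.\<close>

lemma (in warped_chart) soliton_equation_W_iff:
  assumes z: "z \<in> D" and h: "smooth_on U h"
  defines "x \<equiv> vleft z"
  defines "S \<equiv> warped_scalar_curvature G f (scalar_curvature H (vright z)) (real CARD('m)) x"
  shows "(scalar_curvature W z - \<rho>) *\<^sub>R W z = hessian W (\<lambda>z. h (vleft z)) z \<longleftrightarrow>
    (S - \<rho>) *\<^sub>R G x = hessian G h x \<and> (S - \<rho>) * f x = derivation (gradient G f) h x"
proof -
  have x: "x \<in> U" and y: "vright z \<in> V" using z by (simp_all add: x_def D_iff)
  have S: "scalar_curvature W z = S"
    by (simp add: scalar_curvature_W[OF z] S_def x_def warped_scalar_curvature_def)
  have "H (vright z) \<noteq> 0" by (rule invertible_nonzero[OF H_inv[OF y]])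
  then have "((S - \<rho>) * (f x)\<^sup>2) *\<^sub>R H (vright z) = (f x * derivation (gradient G f) h x) *\<^sub>R H (vright z)
      \<longleftrightarrow> (S - \<rho>) * f x = derivation (gradient G f) h x"
    using f_nz[OF x] by (auto simp: power2_eq_square)
  then show ?thesis
    unfolding S hessian_W[OF z h]
    by (simp add: warped_coords_def scaleR_block_diag block_diag_eq_iff flip: x_def)
qed

text \<open>Nothing in the two equations depends on the fibre coordinates. From left to right one
  point of \<open>F\<close> is needed; it exists because manifolds are nonempty.\<close>

theorem warped_soliton_iff:
  fixes F :: "('q, 'j, 'm::finite) manifold"
  assumes gB: "pseudo_Riemannian B gB" and gF: "pseudo_Riemannian F gF"
    and f: "smooth_function B f" and nz: "\<And>p. p \<in> topspace (mtop B) \<Longrightarrow> f p \<noteq> 0"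
    and h: "smooth_function B h" and lam: "constant_scalar_curvature F gF lam"
  defines "S \<equiv> \<lambda>i. warped_scalar_curvature (gB i) (loc B i f) lam (real CARD('m))"
  shows "gradient_Yamabe_soliton (product_manifold B F) (warped_metric B gB f gF) (h \<circ> fst) \<rho> \<longleftrightarrow>
    (\<forall>i\<in>idx B. \<forall>x\<in>cimage B i.
      (S i x - \<rho>) *\<^sub>R gB i x = hessian (gB i) (loc B i h) x \<and>
      (S i x - \<rho>) * loc B i f x = derivation (gradient (gB i) (loc B i f)) (loc B i h) x)"
    (is "_ \<longleftrightarrow> (\<forall>i\<in>idx B. \<forall>x\<in>cimage B i. ?E i x)")
proof -
  let ?P = "product_manifold B F" and ?W = "warped_metric B gB f gF"
  have B: "smooth_manifold B" and F: "smooth_manifold F"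
    using gB gF by (auto simp: pseudo_Riemannian_def)
  have pointwise: "(scalar_curvature (?W (i, j)) z - \<rho>) *\<^sub>R ?W (i, j) z = hessian (?W (i, j)) (loc ?P (i, j) (h \<circ> fst)) z
      \<longleftrightarrow> ?E i (vleft z)"
    if i: "i \<in> idx B" and j: "j \<in> idx F" and z: "z \<in> coord_prod (cimage B i) (cimage F j)" for i j z
  proof -
    note cB = smooth_manifold_chart[OF B i] and cF = smooth_manifold_chart[OF F j]
    interpret warped_chart "gB i" "loc B i f" "gF j" "cimage B i" "cimage F j"
      using cB(2) cF(2) pseudo_RiemannianD[OF gB i] pseudo_RiemannianD[OF gF j] f i
        loc_nonzero[OF B i _ nz]
      by unfold_locales (auto simp: smooth_function_def)
    have h': "smooth_on (cimage B i) (loc B i h)"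
      using h i by (simp add: smooth_function_def)
    have lamF: "scalar_curvature (gF j) (vright z) = lam"
      using lam j z by (simp add: constant_scalar_curvature_def coord_prod_def)
    have "hessian W (loc ?P (i, j) (h \<circ> fst)) z = hessian W (\<lambda>z. loc B i h (vleft z)) z"
      by (rule hessian_cong_open[OF open_D z loc_product_fst[OF cB(1) cF(1)]])
    then show ?thesis
      using soliton_equation_W_iff[OF z h', of \<rho>] unfolding lamF warped_metric_eq S_def by simp
  qed
  have "gradient_Yamabe_soliton ?P ?W (h \<circ> fst) \<rho> \<longleftrightarrow>
      (\<forall>i\<in>idx B. \<forall>j\<in>idx F. \<forall>z\<in>coord_prod (cimage B i) (cimage F j). ?E i (vleft z))"
    using pseudo_Riemannian_warped[OF gB gF f nz] smooth_function_fst[OF B F h] pointwise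
    by (simp add: gradient_Yamabe_soliton_def cimage_product)
  also have "\<dots> \<longleftrightarrow> (\<forall>i\<in>idx B. \<forall>x\<in>cimage B i. ?E i x)"
  proof -
    obtain q where "q \<in> topspace (mtop F)" using F unfolding smooth_manifold_def by blast
    then obtain j where j: "j \<in> idx F" "q \<in> cdom F j"
      using F unfolding smooth_manifold_def by blast
    then have y: "chart F j q \<in> cimage F j" by (simp add: cimage_def)
    have "?E i x" if *: "\<forall>i\<in>idx B. \<forall>j\<in>idx F. \<forall>z\<in>coord_prod (cimage B i) (cimage F j). ?E i (vleft z)"
      and i: "i \<in> idx B" and x: "x \<in> cimage B i" for i x
    proof -
      have "vjoin x (chart F j q) \<in> coord_prod (cimage B i) (cimage F j)"
        using x y by (simp add: coord_prod_def)
      from *[rule_format, OF i j(1) this] show ?thesis by simp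
    qed
    moreover have "\<forall>i\<in>idx B. \<forall>j\<in>idx F. \<forall>z\<in>coord_prod (cimage B i) (cimage F j). ?E i (vleft z)"
      if "\<forall>i\<in>idx B. \<forall>x\<in>cimage B i. ?E i x"
      using that by (simp add: coord_prod_def)
    ultimately show ?thesis by blast
  qed
  finally show ?thesis .
qed

theorem theorem1p5:
  fixes \<epsilon> :: "'n::finite \<Rightarrow> real"
    and f \<phi> h :: "real^'n \<Rightarrow> real"
    and F :: "('q, 'j, 'm::finite) manifold"
    and gF :: "('j, 'm) metric"
    and lamF \<rho> n m :: real
  assumes n_def: "n = real CARD('n)" and m_def: "m = real CARD('m)"
    and n_ge_3: "CARD('n) \<ge> 3"
    and eps: "\<And>i. \<epsilon> i \<in> {-1, 1}"
    and smooth_f: "smooth_on UNIV f"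
    and smooth_phi: "smooth_on UNIV \<phi>"
    and smooth_h: "smooth_on UNIV h"
    and f_pos: "\<And>x. f x > 0"
    and phi_nonzero: "\<And>x. \<phi> x \<noteq> 0"
    and F_semi_Riemannian: "pseudo_Riemannian F gF"
    and F_scalar: "constant_scalar_curvature F gF lamF"
  shows
    "gradient_Yamabe_soliton
       (product_manifold Euclidean_manifold F)
       (warped_metric Euclidean_manifold
          (conformal_metric Euclidean_manifold \<phi> (pseudo_Euclidean_metric \<epsilon>)) f gF)
       (h \<circ> fst) \<rho>
     \<longleftrightarrow>
     (\<forall>x. \<forall>i j. i \<noteq> j \<longrightarrow>
        pd j (pd i h) x + pd j \<phi> x / \<phi> x * pd i h x + pd i \<phi> x / \<phi> x * pd j h x = 0) \<and>
     (\<forall>x. \<forall>i.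
        ((n - 1) * (2 * \<phi> x * (\<Sum>k\<in>UNIV. \<epsilon> k * pd k (pd k \<phi>) x)
                      - n * (\<Sum>k\<in>UNIV. \<epsilon> k * (pd k \<phi> x)\<^sup>2))
          + lamF / (f x)\<^sup>2
          - 2 * m / f x * ((\<phi> x)\<^sup>2 * (\<Sum>k\<in>UNIV. \<epsilon> k * pd k (pd k f) x)
                      - (n - 2) * \<phi> x * (\<Sum>k\<in>UNIV. \<epsilon> k * pd k \<phi> x * pd k f x))
          - m * (m - 1) / (f x)\<^sup>2 * (\<phi> x)\<^sup>2 * (\<Sum>k\<in>UNIV. \<epsilon> k * (pd k f x)\<^sup>2)
          - \<rho>) * (\<epsilon> i / (\<phi> x)\<^sup>2)
        = pd i (pd i h) x + 2 * (pd i \<phi> x / \<phi> x) * pd i h x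
          - \<epsilon> i * (\<Sum>k\<in>UNIV. \<epsilon> k * (pd k \<phi> x / \<phi> x) * pd k h x)) \<and>
     (\<forall>x.
        (n - 1) * (2 * \<phi> x * (\<Sum>k\<in>UNIV. \<epsilon> k * pd k (pd k \<phi>) x)
                      - n * (\<Sum>k\<in>UNIV. \<epsilon> k * (pd k \<phi> x)\<^sup>2))
          + lamF / (f x)\<^sup>2
          - 2 * m / f x * ((\<phi> x)\<^sup>2 * (\<Sum>k\<in>UNIV. \<epsilon> k * pd k (pd k f) x)
                      - (n - 2) * \<phi> x * (\<Sum>k\<in>UNIV. \<epsilon> k * pd k \<phi> x * pd k f x))
          - m * (m - 1) / (f x)\<^sup>2 * (\<phi> x)\<^sup>2 * (\<Sum>k\<in>UNIV. \<epsilon> k * (pd k f x)\<^sup>2)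
          - \<rho>
        = (\<phi> x)\<^sup>2 / f x * (\<Sum>k\<in>UNIV. \<epsilon> k * pd k f x * pd k h x))"
proof -
  let ?g = "conformal_metric Euclidean_manifold \<phi> (pseudo_Euclidean_metric \<epsilon>)"
  interpret conformally_flat \<epsilon> \<phi> n
    using n_def eps smooth_phi phi_nonzero by unfold_locales auto
  have g_eq: "?g () = gbar"
    by (simp add: gbar_def[abs_def] conformal_metric_def pseudo_Euclidean_metric_def fun_eq_iff)
  have smooth: "smooth_function Euclidean_manifold u" if "smooth_on UNIV u" for u :: "real^'n \<Rightarrow> real"
    using that by (simp add: smooth_function_def)
  have gB: "pseudo_Riemannian Euclidean_manifold ?g"
    by (intro pseudo_Riemannian_conformal pseudo_Riemannian_pseudo_Euclidean smooth smooth_phi phi_nonzero eps)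
  define E where "E x = (n - 1) * (2 * \<phi> x * (\<Sum>k\<in>UNIV. \<epsilon> k * pd k (pd k \<phi>) x)
                      - n * (\<Sum>k\<in>UNIV. \<epsilon> k * (pd k \<phi> x)\<^sup>2))
          + lamF / (f x)\<^sup>2
          - 2 * m / f x * ((\<phi> x)\<^sup>2 * (\<Sum>k\<in>UNIV. \<epsilon> k * pd k (pd k f) x)
                      - (n - 2) * \<phi> x * (\<Sum>k\<in>UNIV. \<epsilon> k * pd k \<phi> x * pd k f x))
          - m * (m - 1) / (f x)\<^sup>2 * (\<phi> x)\<^sup>2 * (\<Sum>k\<in>UNIV. \<epsilon> k * (pd k f x)\<^sup>2)
          - \<rho>" for x
  have S: "warped_scalar_curvature gbar f lamF (real CARD('m)) x - \<rho> = E x" for x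
    unfolding warped_scalar_curvature_def scalar_curvature_gbar metric_trace_hessian_gbar
      divergence_gradient_gbar[OF smooth_f] derivation_gradient_gbar E_def m_def[symmetric]
    by (simp add: power2_eq_square mult.assoc)
  define N where "N x = (\<Sum>k\<in>UNIV. \<epsilon> k * (pd k \<phi> x / \<phi> x) * pd k h x)" for x
  have base: "E x *\<^sub>R gbar x = hessian gbar h x \<longleftrightarrow>
      (\<forall>i j. i \<noteq> j \<longrightarrow>
        pd j (pd i h) x + pd j \<phi> x / \<phi> x * pd i h x + pd i \<phi> x / \<phi> x * pd j h x = 0) \<and>
      (\<forall>i. E x * (\<epsilon> i / (\<phi> x)\<^sup>2)
        = pd i (pd i h) x + 2 * (pd i \<phi> x / \<phi> x) * pd i h x - \<epsilon> i * N x)" for x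
  proof -
    (* The entry (i, j) of the Hessian is the off-diagonal equation with i and j exchanged. *)
  have entry: "(E x *\<^sub>R gbar x) $ i $ j = hessian gbar h x $ i $ j \<longleftrightarrow>
        (if i = j then E x * (\<epsilon> i / (\<phi> x)\<^sup>2)
          = pd i (pd i h) x + 2 * (pd i \<phi> x / \<phi> x) * pd i h x - \<epsilon> i * N x
         else pd i (pd j h) x + pd i \<phi> x / \<phi> x * pd j h x + pd j \<phi> x / \<phi> x * pd i h x = 0)" for i j
      unfolding hessian_gbar N_def dlog_def by (auto simp: gbar_def)
    show ?thesis
      unfolding vec_eq_iff[of "E x *\<^sub>R gbar x"] vec_eq_iff[of "(E x *\<^sub>R gbar x) $ _"] entry by auto
  qed
  have fibre: "E x * f x = derivation (gradient gbar f) h x \<longleftrightarrow>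
      E x = (\<phi> x)\<^sup>2 / f x * (\<Sum>k\<in>UNIV. \<epsilon> k * pd k f x * pd k h x)" for x
    using f_pos[of x] by (auto simp: derivation_gradient_gbar field_simps)
  have soliton: "gradient_Yamabe_soliton (product_manifold Euclidean_manifold F)
      (warped_metric Euclidean_manifold ?g f gF) (h \<circ> fst) \<rho> \<longleftrightarrow>
      (\<forall>x. E x *\<^sub>R gbar x = hessian gbar h x \<and> E x * f x = derivation (gradient gbar f) h x)"
    using warped_soliton_iff[OF gB F_semi_Riemannian smooth[OF smooth_f] _ smooth[OF smooth_h] F_scalar, of \<rho>]
      f_pos by (simp add: g_eq S less_imp_neq[symmetric])
  show ?thesis
    unfolding E_def[symmetric] N_def[symmetric] soliton base fibre
    by (simp only: all_conj_distrib conj_assoc)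
qed

end
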